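(* Let $\Phi:\mathbb R^d\to\mathbb R^d$ be of the form $\Phi(x)=\mathsf A x+v(x)$, where $v$ is $C^2$, $0$ is a fixed point of $\Phi$, $\mathsf A=D\Phi(0)$, and $\mathsf A$ is a diagonalizable matrix with eigenvalues $\lambda_1,\dots,\lambda_d$ satisfying $|\lambda_i|<1$. Let $\mathscr F_\Phi$ be the pullback space of observables associated with $\Phi$ defined in the context, and let $U_\Phi:\mathscr F_\Phi\to\mathscr F_\Phi$, $U_\Phi\psi=\psi\circ\Phi$, be the Koopman operator. Then $U_\Phi$ is a spectral operator of scalar type, and its spectrum is $$\sigma(U_\Phi)=\Big\{\prod_{i=1}^d\lambda_i^{k_i} : k_i\in\mathbb N_0\ \text{for all } i\in\{1,\dots,d\}\Big\}.$$
   Context: Construction of $\mathscr F_\Phi$. Let $\mathbf v_1,\dots,\mathbf v_d$ be a basis of eigenvectors of $\mathsf A$ for $\lambda_1,\dots,\lambda_d$, and $\mathbf w_1,\dots,\mathbf w_d$ the adjoint basis, $\langle \mathbf v_j,\mathbf w_k\rangle=\delta_{jk}$. The linear functionals $\phi_j(\mathbf y)=\langle\mathbf y,\mathbf w_j\rangle$ satisfy $\phi_j(\mathsf A\mathbf y)=\lambda_j\phi_j(\mathbf y)$; put $\hat{\mathbf y}=(\hat y_1,\dots,\hat y_d)$ with $\hat y_j=\phi_j(\mathbf y)$. Let $D\subset\mathbb R^d$ be the basin of attraction of the fixed point $0$ of $\Phi$. By a known theorem (Lan and Mezić) there is a $C^1$ diffeomorphism $h:D\to h(D)$ with $h\circ\Phi=\mathsf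 A\circ h$; fix such an $h$. Let $B\subset D$ be a bounded, simply connected, positively invariant open set containing the origin, with smooth boundary, such that $h(B)$ is bounded, and let $g$ be a diffeomorphism that scales coordinates and maps an open cube $Q_r\supset h(B)$ onto the open unit cube $Q_1$, so that every coordinate $\hat y_j$ has modulus strictly less than $1$ on $D_1:=(g\circ h)(B)$. Let $H^2_{\mathscr B}(D_1)$ be the completion of the space of complex polynomials in $\hat y_1,\dots,\hat y_d$ under the norm $\|\sum_k\alpha_k\hat{\mathbf y}^k\|=(\sum_k|\alpha_k|^2)^{1/2}$, identified with the space of functions $\sum_{k\in\mathbb N_0^d}\alpha_k\,\phi_1^{k_1}\cdots\phi_d^{k_d}$ on $D_1$ with $\sum_k|\alpha_k|^2<\infty$. Then $$\mathscr F_\Phi:=\{\psi\circ g\circ h : \psi\in H^2_{\mathscr B}(D_1)\}$$ is a Banach space of functions on $B$, with elements $\sum_{k\in\mathbb N_0^d}\alpha_k\,(\phi_1^{k_1}\cdots\phi_d^{k_d})\circ g\circ h$, $\sum_k|\alpha_k|^2<\infty$, and norm $(\sum_k|\alpha_k|^2)^{1/2}$. The resolvent set of an operator $U$ is the set of $\xi\in\mathbb C$ such that the image of $\xi I-U$ is dense and $(\xi I-U)^{-1}$ exists and is continuous; $\sigma(U)$ is its complement in $\mathbb C$. A bounded operator $U$ on a Banach space $X$ is a spectral operator of scalar type if $U=\int_{\mathbb C}z\,E(dz)$ for a spectral measure $E$: a set function from the Borel sets of $\mathbb C$ to bounded operators on $X$, countably additive in the weak operator topology, with $E(\mathbb C)=I$,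 $E(A_1\cap A_2)=E(A_1)E(A_2)$, uniformly bounded values, and compact support.
   Formalization: The spectrum is proved to be the set of products together with 0; the printed equality fails when no eigenvalue is 0 (e.g. d=1, Φ(x)=x/2: 0 lies in the spectrum since the inverse is unbounded, but 0 is not a product), and agrees with the formal one if some eigenvalue is 0. *)

theory Defs
  imports "HOL-Analysis.Analysis"
begin

section \<open>Differentiability classes\<close>

text \<open>On an open subset of a finite-dimensional space this is the usual notion of being
  \<open>k\<close> times continuously differentiable.\<close>

primrec Ck_on :: "nat \<Rightarrow> 'a::real_normed_vector set \<Rightarrow> ('a \<Rightarrow> 'b::real_normed_vector) \<Rightarrow> bool" where
  "Ck_on 0 S f \<longleftrightarrow> continuous_on S f"
| "Ck_on (Suc k) S f \<longleftrightarrow> (\<forall>x\<in>S. f differentiable (at x)) \<and>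
     (\<forall>u. Ck_on k S (\<lambda>x. frechet_derivative f (at x) u))"

definition C1_diffeo_on :: "'a::real_normed_vector set \<Rightarrow> ('a \<Rightarrow> 'b::real_normed_vector) \<Rightarrow> bool" where
  "C1_diffeo_on S f \<longleftrightarrow> open S \<and> open (f ` S) \<and> inj_on f S \<and>
     Ck_on 1 S f \<and> Ck_on 1 (f ` S) (inv_into S f)"

text \<open>For an open set \<open>B\<close>: near each boundary point, \<open>B\<close> is the negativity set of a smooth
  function with nonvanishing derivative there.\<close>

definition smooth_boundary :: "'a::real_normed_vector set \<Rightarrow> bool" where
  "smooth_boundary B \<longleftrightarrow> (\<forall>p\<in>frontier B. \<exists>V (\<rho>::'a \<Rightarrow> real).
     open V \<and> p \<in> V \<and> (\<forall>k. Ck_on k V \<rho>) \<and>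
     frechet_derivative \<rho> (at p) \<noteq> (\<lambda>_. 0) \<and> B \<inter> V = {x\<in>V. \<rho> x < 0})"


section \<open>Operators on complex Banach spaces of functions\<close>

text \<open>A normed space of complex functions is given by its carrier \<open>X\<close> and its norm \<open>N\<close>, with
  pointwise vector operations. Operators and functionals are only meaningful on \<open>X\<close>.\<close>

definition function_banach_space :: "('x \<Rightarrow> complex) set \<Rightarrow> (('x \<Rightarrow> complex) \<Rightarrow> real) \<Rightarrow> bool" where
  "function_banach_space X N \<longleftrightarrow>
     (\<lambda>_. 0) \<in> X \<and>
     (\<forall>f\<in>X. \<forall>g\<in>X. (\<lambda>x. f x + g x) \<in> X) \<and>
     (\<forall>c. \<forall>f\<in>X. (\<lambda>x. c * f x) \<in> X) \<and>
     (\<forall>f\<in>X. 0 \<le> N f \<and> (N f = 0 \<longleftrightarrow> f = (\<lambda>_. 0))) \<and>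
     (\<forall>f\<in>X. \<forall>g\<in>X. N (\<lambda>x. f x + g x) \<le> N f + N g) \<and>
     (\<forall>c. \<forall>f\<in>X. N (\<lambda>x. c * f x) = cmod c * N f) \<and>
     (\<forall>F. (\<forall>n. F n \<in> X) \<and>
          (\<forall>\<epsilon>>0. \<exists>M. \<forall>m\<ge>M. \<forall>n\<ge>M. N (\<lambda>x. F m x - F n x) < \<epsilon>) \<longrightarrow>
          (\<exists>f\<in>X. (\<lambda>n. N (\<lambda>x. F n x - f x)) \<longlonglongrightarrow> 0))"

definition bounded_operator ::
    "('x \<Rightarrow> complex) set \<Rightarrow> (('x \<Rightarrow> complex) \<Rightarrow> real) \<Rightarrow> (('x \<Rightarrow> complex) \<Rightarrow> ('x \<Rightarrow> complex)) \<Rightarrow> bool" where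
  "bounded_operator X N T \<longleftrightarrow>
     (\<forall>f\<in>X. T f \<in> X) \<and>
     (\<forall>f\<in>X. \<forall>g\<in>X. T (\<lambda>x. f x + g x) = (\<lambda>x. T f x + T g x)) \<and>
     (\<forall>c. \<forall>f\<in>X. T (\<lambda>x. c * f x) = (\<lambda>x. c * T f x)) \<and>
     (\<exists>M. \<forall>f\<in>X. N (T f) \<le> M * N f)"

definition bounded_functional ::
    "('x \<Rightarrow> complex) set \<Rightarrow> (('x \<Rightarrow> complex) \<Rightarrow> real) \<Rightarrow> (('x \<Rightarrow> complex) \<Rightarrow> complex) \<Rightarrow> bool" where
  "bounded_functional X N l \<longleftrightarrow>
     (\<forall>f\<in>X. \<forall>g\<in>X. l (\<lambda>x. f x + g x) = l f + l g) \<and>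
     (\<forall>c. \<forall>f\<in>X. l (\<lambda>x. c * f x) = c * l f) \<and>
     (\<exists>M. \<forall>f\<in>X. cmod (l f) \<le> M * N f)"

definition resolvent_set ::
    "('x \<Rightarrow> complex) set \<Rightarrow> (('x \<Rightarrow> complex) \<Rightarrow> real) \<Rightarrow> (('x \<Rightarrow> complex) \<Rightarrow> ('x \<Rightarrow> complex)) \<Rightarrow> complex set" where
  "resolvent_set X N U = {\<xi>.
     let T = (\<lambda>f x. \<xi> * f x - U f x) in
       (\<forall>f\<in>X. \<forall>\<epsilon>>0. \<exists>g\<in>T ` X. N (\<lambda>x. f x - g x) < \<epsilon>) \<and>
       inj_on T X \<and>
       (\<forall>f\<in>T ` X. \<forall>\<epsilon>>0. \<exists>\<delta>>0. \<forall>g\<in>T ` X. N (\<lambda>x. g x - f x) < \<delta> \<longrightarrow>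
          N (\<lambda>x. inv_into X T g x - inv_into X T f x) < \<epsilon>)}"

definition op_spectrum ::
    "('x \<Rightarrow> complex) set \<Rightarrow> (('x \<Rightarrow> complex) \<Rightarrow> real) \<Rightarrow> (('x \<Rightarrow> complex) \<Rightarrow> ('x \<Rightarrow> complex)) \<Rightarrow> complex set" where
  "op_spectrum X N U = - resolvent_set X N U"

definition spectral_measure ::
    "('x \<Rightarrow> complex) set \<Rightarrow> (('x \<Rightarrow> complex) \<Rightarrow> real) \<Rightarrow>
     (complex set \<Rightarrow> ('x \<Rightarrow> complex) \<Rightarrow> ('x \<Rightarrow> complex)) \<Rightarrow> bool" where
  "spectral_measure X N E \<longleftrightarrow>
     (\<forall>A\<in>sets borel. bounded_operator X N (E A)) \<and>
     (\<forall>A. range A \<subseteq> sets borel \<and> disjoint_family A \<longrightarrow>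
        (\<forall>f\<in>X. \<forall>l. bounded_functional X N l \<longrightarrow>
           (\<lambda>n::nat. l (E (A n) f)) sums l (E (\<Union>n. A n) f))) \<and>
     (\<forall>f\<in>X. E UNIV f = f) \<and>
     (\<forall>A\<in>sets borel. \<forall>B\<in>sets borel. \<forall>f\<in>X. E (A \<inter> B) f = E A (E B f)) \<and>
     (\<exists>M. \<forall>A\<in>sets borel. \<forall>f\<in>X. N (E A f) \<le> M * N f) \<and>
     (\<exists>K. compact K \<and> (\<forall>f\<in>X. E K f = f))"

text \<open>The integral with respect to a spectral measure is, as in Dunford and Schwartz, the
  operator-norm limit of the integrals of simple functions converging uniformly to the integrand,
  here on a compact set carrying \<open>E\<close>.\<close>

definition simple_spectral_integral ::
    "(complex set \<Rightarrow> ('x \<Rightarrow> complex) \<Rightarrow> ('x \<Rightarrow> complex)) \<Rightarrow> (complex \<Rightarrow> complex) \<Rightarrow>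
     ('x \<Rightarrow> complex) \<Rightarrow> ('x \<Rightarrow> complex)" where
  "simple_spectral_integral E s f = (\<lambda>x. \<Sum>c\<in>range s. c * E (s -` {c}) f x)"

definition has_spectral_integral ::
    "('x \<Rightarrow> complex) set \<Rightarrow> (('x \<Rightarrow> complex) \<Rightarrow> real) \<Rightarrow>
     (complex set \<Rightarrow> ('x \<Rightarrow> complex) \<Rightarrow> ('x \<Rightarrow> complex)) \<Rightarrow> (complex \<Rightarrow> complex) \<Rightarrow>
     (('x \<Rightarrow> complex) \<Rightarrow> ('x \<Rightarrow> complex)) \<Rightarrow> bool" where
  "has_spectral_integral X N E \<theta> T \<longleftrightarrow>
     (\<exists>K s. compact K \<and> (\<forall>f\<in>X. E K f = f) \<and>
        (\<forall>n::nat. simple_function borel (s n)) \<and> uniform_limit K s \<theta> sequentially \<and>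
        (\<forall>\<epsilon>>0. \<forall>\<^sub>F n in sequentially. \<forall>f\<in>X.
           N (\<lambda>x. simple_spectral_integral E (s n) f x - T f x) \<le> \<epsilon> * N f))"

definition scalar_type_spectral_operator ::
    "('x \<Rightarrow> complex) set \<Rightarrow> (('x \<Rightarrow> complex) \<Rightarrow> real) \<Rightarrow> (('x \<Rightarrow> complex) \<Rightarrow> ('x \<Rightarrow> complex)) \<Rightarrow> bool" where
  "scalar_type_spectral_operator X N U \<longleftrightarrow>
     function_banach_space X N \<and> bounded_operator X N U \<and>
     (\<exists>E. spectral_measure X N E \<and> has_spectral_integral X N E (\<lambda>z. z) U)"


section \<open>Eigencoordinates and the pullback space\<close>

definition basin :: "('a::real_normed_vector \<Rightarrow> 'a) \<Rightarrow> 'a set" where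
  "basin \<Phi> = {x. (\<lambda>n. (\<Phi> ^^ n) x) \<longlonglongrightarrow> 0}"

definition cinner_vec :: "complex^'n \<Rightarrow> complex^'n \<Rightarrow> complex" where
  "cinner_vec a b = (\<Sum>i\<in>UNIV. a $ i * cnj (b $ i))"

text \<open>The matrix \<open>A\<close> is real, but its eigenvalues and eigenvectors may be complex.\<close>

definition eigenbasis :: "real^'n^'n \<Rightarrow> ('n \<Rightarrow> complex) \<Rightarrow> ('n \<Rightarrow> complex^'n) \<Rightarrow> bool" where
  "eigenbasis A lam v \<longleftrightarrow>
     inj v \<and> vec.independent (range v) \<and> vec.span (range v) = UNIV \<and>
     (\<forall>j. map_matrix complex_of_real A *v v j = lam j *s v j)"

definition adjoint_basis :: "('n \<Rightarrow> complex^'n) \<Rightarrow> ('n \<Rightarrow> complex^'n) \<Rightarrow> bool" where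
  "adjoint_basis v w \<longleftrightarrow> (\<forall>j k. cinner_vec (v j) (w k) = (if j = k then 1 else 0))"

definition eigencoord :: "('n \<Rightarrow> complex^'n) \<Rightarrow> 'n \<Rightarrow> real^'n \<Rightarrow> complex" where
  "eigencoord w j y = cinner_vec (\<chi> i. complex_of_real (y $ i)) (w j)"

text \<open>The cube is taken in eigencoordinates: this is what makes every coordinate of a point of
  the unit cube have modulus less than 1.\<close>

definition open_cube :: "('n \<Rightarrow> complex^'n) \<Rightarrow> real \<Rightarrow> (real^'n) set" where
  "open_cube w r = {y. \<forall>j. cmod (eigencoord w j y) < r}"

definition scales_coords_on ::
    "('n \<Rightarrow> complex^'n) \<Rightarrow> (real^'n) set \<Rightarrow> (real^'n \<Rightarrow> real^'n) \<Rightarrow> bool" where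
  "scales_coords_on w S g \<longleftrightarrow>
     (\<exists>c. (\<forall>j. 0 < c j) \<and>
          (\<forall>y\<in>S. \<forall>j. eigencoord w j (g y) = complex_of_real (c j) * eigencoord w j y))"

definition square_summable :: "('k \<Rightarrow> complex) \<Rightarrow> bool" where
  "square_summable \<alpha> \<longleftrightarrow> (\<lambda>k. (cmod (\<alpha> k))\<^sup>2) summable_on UNIV"

text \<open>Functions on \<open>D\<close> are represented by their extension by 0, so that equality of functions
  means equality on \<open>D\<close>.\<close>

definition power_series_fun ::
    "('n::finite \<Rightarrow> complex^'n) \<Rightarrow> (real^'n) set \<Rightarrow> (('n \<Rightarrow> nat) \<Rightarrow> complex) \<Rightarrow> real^'n \<Rightarrow> complex" where
  "power_series_fun w D \<alpha> =
     (\<lambda>y. if y \<in> D then (\<Sum>\<^sub>\<infinity>k. \<alpha> k * (\<Prod>j\<in>UNIV. eigencoord w j y ^ k j)) else 0)"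

definition polydisc_hardy_space ::
    "('n::finite \<Rightarrow> complex^'n) \<Rightarrow> (real^'n) set \<Rightarrow> (real^'n \<Rightarrow> complex) set" where
  "polydisc_hardy_space w D = {power_series_fun w D \<alpha> |\<alpha>. square_summable \<alpha>}"

definition pullback ::
    "(real^'n \<Rightarrow> real^'n) \<Rightarrow> (real^'n) set \<Rightarrow> (real^'n \<Rightarrow> complex) \<Rightarrow> real^'n \<Rightarrow> complex" where
  "pullback \<gamma> B \<psi> = (\<lambda>x. if x \<in> B then \<psi> (\<gamma> x) else 0)"

definition pullback_space ::
    "('n::finite \<Rightarrow> complex^'n) \<Rightarrow> (real^'n \<Rightarrow> real^'n) \<Rightarrow> (real^'n \<Rightarrow> real^'n) \<Rightarrow> (real^'n) set \<Rightarrow>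
     (real^'n \<Rightarrow> complex) set" where
  "pullback_space w g h B = pullback (g \<circ> h) B ` polydisc_hardy_space w ((g \<circ> h) ` B)"

text \<open>The coefficients are unique when \<open>(g \<circ> h) ` B\<close> is a neighbourhood of 0 contained in the
  unit cube.\<close>

definition pullback_coeffs ::
    "('n::finite \<Rightarrow> complex^'n) \<Rightarrow> (real^'n \<Rightarrow> real^'n) \<Rightarrow> (real^'n \<Rightarrow> real^'n) \<Rightarrow> (real^'n) set \<Rightarrow>
     (real^'n \<Rightarrow> complex) \<Rightarrow> ('n \<Rightarrow> nat) \<Rightarrow> complex" where
  "pullback_coeffs w g h B f =
     (THE \<alpha>. square_summable \<alpha> \<and> f = pullback (g \<circ> h) B (power_series_fun w ((g \<circ> h) ` B) \<alpha>))"

definition pullback_norm ::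
    "('n::finite \<Rightarrow> complex^'n) \<Rightarrow> (real^'n \<Rightarrow> real^'n) \<Rightarrow> (real^'n \<Rightarrow> real^'n) \<Rightarrow> (real^'n) set \<Rightarrow>
     (real^'n \<Rightarrow> complex) \<Rightarrow> real" where
  "pullback_norm w g h B f = sqrt (\<Sum>\<^sub>\<infinity>k. (cmod (pullback_coeffs w g h B f k))\<^sup>2)"

definition koopman ::
    "(real^'n) set \<Rightarrow> (real^'n \<Rightarrow> real^'n) \<Rightarrow> (real^'n \<Rightarrow> complex) \<Rightarrow> real^'n \<Rightarrow> complex" where
  "koopman B \<Phi> = pullback \<Phi> B"

end

theory Submission
  imports Defs "HOL-Complex_Analysis.Cauchy_Integral_Formula"
begin

text \<open>In the coordinates of \<open>g \<circ> h\<close> the map \<open>\<Phi>\<close> becomes multiplication of the \<open>j\<close>-th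
  eigencoordinate by \<open>\<lambda>\<^sub>j\<close>, so on the power series coefficients, which identify the pullback space
  isometrically with \<open>\<ell>\<^sup>2\<close> over the multi-indices, the Koopman operator acts as the diagonal operator
  with entries \<open>\<lambda>\<^sup>k\<close>. A bounded diagonal operator has the coordinate projections as spectral measure,
  and its spectrum is the closure of its set of entries; here the entries accumulate only at 0.

  The identification rests on the uniqueness of the coefficients. For complex eigenvalues the
  eigencoordinates map \<open>\<real>\<^sup>d\<close> to a maximal totally real subspace of \<open>\<complex>\<^sup>d\<close>: along real rays through the origin
  the homogeneous parts of a vanishing series vanish separately, and a polynomial vanishing on the
  subspace vanishes on its complexification.\<close>

section \<open>Diagonal operators on spaces isometric to \<open>\<ell>\<^sup>2\<close>\<close>

definition l2_norm :: "('k \<Rightarrow> complex) \<Rightarrow> real" where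
  "l2_norm a = sqrt (\<Sum>\<^sub>\<infinity>k. (cmod (a k))\<^sup>2)"

lemma l2_norm_nonneg [simp]: "0 \<le> l2_norm a"
  by (simp add: l2_norm_def infsum_nonneg)

lemma l2_norm_zero [simp]: "l2_norm (\<lambda>_. 0) = 0"
  by (simp add: l2_norm_def)

lemma square_summable_zero [simp]: "square_summable (\<lambda>_. 0)"
  by (simp add: square_summable_def)

lemma L2_set_le_l2_norm:
  assumes "square_summable a" "finite F"
  shows "L2_set (\<lambda>k. cmod (a k)) F \<le> l2_norm a"
  unfolding L2_set_def l2_norm_def
  by (rule real_sqrt_le_mono, rule finite_sum_le_infsum)
     (use assms in \<open>auto simp: square_summable_def\<close>)

lemma cmod_le_l2_norm:
  assumes "square_summable a"
  shows "cmod (a k) \<le> l2_norm a"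
  using L2_set_le_l2_norm[OF assms, of "{k}"] by simp

lemma l2_norm_eq_0_iff:
  assumes "square_summable a"
  shows "l2_norm a = 0 \<longleftrightarrow> a = (\<lambda>_. 0)"
  using cmod_le_l2_norm[OF assms] by (fastforce intro: ext)

text \<open>A bound uniform over finite sets gives summability and the norm bound together. The
  first conclusion is what gives the second its meaning, since \<open>infsum\<close> defaults to 0
  on families that are not summable.\<close>

lemma square_summable_if_L2_set_bounded:
  assumes "\<And>F. finite F \<Longrightarrow> L2_set (\<lambda>k. cmod (a k)) F \<le> C"
  shows "square_summable a" and "l2_norm a \<le> C"
proof -
  have C: "0 \<le> C"
    using assms[of "{}"] by simp
  have bd: "(\<Sum>k\<in>F. (cmod (a k))\<^sup>2) \<le> C\<^sup>2" if "finite F" for F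
    using assms[OF that] C
    by (metis L2_set_def sqrt_le_D)
  show ss: "square_summable a"
    unfolding square_summable_def
    by (rule nonneg_bdd_above_summable_on) (use bd in \<open>auto intro!: bdd_aboveI2\<close>)
  have "(\<Sum>\<^sub>\<infinity>k. (cmod (a k))\<^sup>2) \<le> C\<^sup>2"
    by (rule infsum_le_finite_sums) (use ss bd in \<open>auto simp: square_summable_def\<close>)
  then show "l2_norm a \<le> C"
    unfolding l2_norm_def using C real_le_lsqrt by blast
qed

lemma square_summable_add:
  assumes "square_summable a" "square_summable b"
  shows "square_summable (\<lambda>k. a k + b k)" and "l2_norm (\<lambda>k. a k + b k) \<le> l2_norm a + l2_norm b"
proof -
  have bd: "L2_set (\<lambda>k. cmod (a k + b k)) F \<le> l2_norm a + l2_norm b" if "finite F" for F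
  proof -
    have "L2_set (\<lambda>k. cmod (a k + b k)) F \<le> L2_set (\<lambda>k. cmod (a k) + cmod (b k)) F"
      by (intro L2_set_mono norm_triangle_ineq norm_ge_zero)
    also have "\<dots> \<le> L2_set (\<lambda>k. cmod (a k)) F + L2_set (\<lambda>k. cmod (b k)) F"
      by (rule L2_set_triangle_ineq)
    also have "\<dots> \<le> l2_norm a + l2_norm b"
      by (intro add_mono L2_set_le_l2_norm assms that)
    finally show ?thesis .
  qed
  show "square_summable (\<lambda>k. a k + b k)"
    by (rule square_summable_if_L2_set_bounded(1), rule bd)
  show "l2_norm (\<lambda>k. a k + b k) \<le> l2_norm a + l2_norm b"
    by (rule square_summable_if_L2_set_bounded(2), rule bd)
qed

lemma square_summable_mult_bounded:
  assumes "square_summable a" "\<And>k. cmod (m k) \<le> C"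
  shows "square_summable (\<lambda>k. m k * a k)" and "l2_norm (\<lambda>k. m k * a k) \<le> C * l2_norm a"
proof -
  have C: "0 \<le> C"
    using assms(2) norm_ge_zero order_trans by blast
  have bd: "L2_set (\<lambda>k. cmod (m k * a k)) F \<le> C * l2_norm a" if "finite F" for F
  proof -
    have "L2_set (\<lambda>k. cmod (m k * a k)) F \<le> L2_set (\<lambda>k. C * cmod (a k)) F"
      by (intro L2_set_mono) (auto simp: norm_mult intro: mult_right_mono assms(2))
    also have "\<dots> = C * L2_set (\<lambda>k. cmod (a k)) F"
      using C by (simp add: L2_set_right_distrib)
    also have "\<dots> \<le> C * l2_norm a"
      by (intro mult_left_mono L2_set_le_l2_norm assms that C)
    finally show ?thesis .
  qed
  show "square_summable (\<lambda>k. m k * a k)"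
    by (rule square_summable_if_L2_set_bounded(1), rule bd)
  show "l2_norm (\<lambda>k. m k * a k) \<le> C * l2_norm a"
    by (rule square_summable_if_L2_set_bounded(2), rule bd)
qed

lemma square_summable_scale:
  assumes "square_summable a"
  shows "square_summable (\<lambda>k. c * a k)" and "l2_norm (\<lambda>k. c * a k) = cmod c * l2_norm a"
proof -
  show "square_summable (\<lambda>k. c * a k)"
    by (rule square_summable_mult_bounded(1)[OF assms order_refl])
  show "l2_norm (\<lambda>k. c * a k) = cmod c * l2_norm a"
    unfolding l2_norm_def
    by (simp add: norm_mult power_mult_distrib infsum_cmult_right' real_sqrt_mult)
qed

lemma square_summable_diff:
  assumes "square_summable a" "square_summable b"
  shows "square_summable (\<lambda>k. a k - b k)"
  using square_summable_add(1)[OF assms(1) square_summable_scale(1)[OF assms(2), of "- 1"]] by simp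

lemma square_summable_unit: "square_summable (\<lambda>k. if k = i then c else 0)"
  and l2_norm_unit: "l2_norm (\<lambda>k. if k = i then c else 0) = cmod c"
proof -
  have bd: "L2_set (\<lambda>k. cmod (if k = i then c else 0)) F \<le> cmod c" if "finite F" for F
  proof -
    have "(\<Sum>k\<in>F. (cmod (if k = i then c else 0))\<^sup>2) = (\<Sum>k\<in>F. if k = i then (cmod c)\<^sup>2 else 0)"
      by (intro sum.cong) auto
    then show ?thesis
      using that by (auto simp: L2_set_def)
  qed
  show "square_summable (\<lambda>k. if k = i then c else 0)"
    by (rule square_summable_if_L2_set_bounded(1), rule bd)
  from cmod_le_l2_norm[OF this, of i] square_summable_if_L2_set_bounded(2)[OF bd]
  show "l2_norm (\<lambda>k. if k = i then c else 0) = cmod c"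
    by simp
qed

text \<open>A finite set carries all but \<epsilon> squared of the squared norm. Quantifying over
  multipliers lets one \<open>F\<close> serve all indicator functions of the tails in the proof of
  countable additivity.\<close>

lemma l2_norm_tail:
  assumes "square_summable a" "\<epsilon> > 0"
  obtains F where "finite F"
    "\<And>m. \<lbrakk>\<And>k. cmod (m k) \<le> 1; \<And>k. k \<in> F \<Longrightarrow> m k = 0\<rbrakk> \<Longrightarrow> l2_norm (\<lambda>k. m k * a k) \<le> \<epsilon>"
proof -
  let ?q = "\<lambda>k. (cmod (a k))\<^sup>2"
  have q: "?q summable_on UNIV"
    using assms(1) by (simp add: square_summable_def)
  obtain F where F: "finite F" "dist (sum ?q F) (infsum ?q UNIV) \<le> \<epsilon>\<^sup>2"
    using infsum_finite_approximation[OF q, of "\<epsilon>\<^sup>2"] assms(2) by auto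
  show ?thesis
  proof (rule that[OF F(1)])
    fix m :: "'a \<Rightarrow> complex"
    assume m: "\<And>k. cmod (m k) \<le> 1" "\<And>k. k \<in> F \<Longrightarrow> m k = 0"
    have "L2_set (\<lambda>k. cmod (m k * a k)) G \<le> \<epsilon>" if G: "finite G" for G
    proof -
      have "(\<Sum>k\<in>G. (cmod (m k * a k))\<^sup>2) = (\<Sum>k\<in>G - F. (cmod (m k * a k))\<^sup>2)"
        by (rule sum.mono_neutral_right) (use G m in auto)
      also have "\<dots> \<le> sum ?q (G - F)"
        by (intro sum_mono power_mono) (use m(1) in \<open>auto simp: norm_mult intro: mult_left_le_one_le\<close>)
      also have "\<dots> = sum ?q (F \<union> G) - sum ?q F"
        using F(1) G by (subst Un_commute) (simp add: sum_diff[symmetric] Un_Diff)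
      also have "\<dots> \<le> infsum ?q UNIV - sum ?q F"
        using finite_sum_le_infsum[OF q, of "F \<union> G"] F(1) G by simp
      also have "\<dots> \<le> \<epsilon>\<^sup>2"
        using F(2) by (simp add: dist_real_def)
      finally show ?thesis
        unfolding L2_set_def using assms(2) by (simp add: real_le_lsqrt)
    qed
    then show "l2_norm (\<lambda>k. m k * a k) \<le> \<epsilon>"
      by (rule square_summable_if_L2_set_bounded)
  qed
qed

text \<open>The limit is taken coordinate by coordinate. On each finite set the Cauchy bound
  survives the limit, and bounds uniform over finite sets return both square summability and the
  norm estimate.\<close>

lemma l2_complete:
  assumes ss: "\<And>n::nat. square_summable (a n)"
    and cauchy: "\<And>\<epsilon>. \<epsilon> > 0 \<Longrightarrow> \<exists>M. \<forall>m\<ge>M. \<forall>n\<ge>M. l2_norm (\<lambda>k. a m k - a n k) < \<epsilon>"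
  obtains b where "square_summable b" "(\<lambda>n. l2_norm (\<lambda>k. a n k - b k)) \<longlonglongrightarrow> 0"
proof -
  have "Cauchy (\<lambda>n. a n k)" for k
  proof (rule CauchyI)
    fix e :: real assume "e > 0"
    then obtain M where M: "\<forall>m\<ge>M. \<forall>n\<ge>M. l2_norm (\<lambda>k. a m k - a n k) < e"
      using cauchy by blast
    have "cmod (a m k - a n k) < e" if "m \<ge> M" "n \<ge> M" for m n
      using cmod_le_l2_norm[OF square_summable_diff[OF ss[of m] ss[of n]], of k] M that
      by (metis order_le_less_trans)
    then show "\<exists>M. \<forall>m\<ge>M. \<forall>n\<ge>M. norm (a m k - a n k) < e"
      by blast
  qed
  then have "\<forall>k. \<exists>l. (\<lambda>n. a n k) \<longlonglongrightarrow> l"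
    by (simp add: Cauchy_convergent_iff convergent_def)
  then obtain b where b: "\<And>k. (\<lambda>n. a n k) \<longlonglongrightarrow> b k"
    by metis
  have key: "\<exists>M. \<forall>n\<ge>M. square_summable (\<lambda>k. a n k - b k) \<and> l2_norm (\<lambda>k. a n k - b k) \<le> e"
    if e: "e > 0" for e
  proof -
    obtain M where M: "\<forall>m\<ge>M. \<forall>n\<ge>M. l2_norm (\<lambda>k. a m k - a n k) < e"
      using cauchy[OF e] by blast
    have "L2_set (\<lambda>k. cmod (a n k - b k)) F \<le> e" if "n \<ge> M" "finite F" for n F
    proof (rule tendsto_upperbound)
      show "(\<lambda>m. L2_set (\<lambda>k. cmod (a n k - a m k)) F) \<longlonglongrightarrow> L2_set (\<lambda>k. cmod (a n k - b k)) F"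
        unfolding L2_set_def by (intro tendsto_intros b)
      show "\<forall>\<^sub>F m in sequentially. L2_set (\<lambda>k. cmod (a n k - a m k)) F \<le> e"
        using eventually_ge_at_top[of M]
      proof eventually_elim
        case (elim m)
        then show ?case
          using L2_set_le_l2_norm[OF square_summable_diff[OF ss[of n] ss[of m]] that(2)] M that(1)
          by (metis order_less_imp_le order_trans)
      qed
    qed simp
    then show ?thesis
      by (metis square_summable_if_L2_set_bounded)
  qed
  \<comment> \<open>A single square-summable difference suffices, because \<open>b\<close> is
    \<open>a n\<close> minus that difference.\<close>
  from key[of 1] obtain n where n: "square_summable (\<lambda>k. a n k - b k)"
    by auto
  have ssb: "square_summable b"
    using square_summable_diff[OF ss[of n] n] by simp
  have "(\<lambda>n. l2_norm (\<lambda>k. a n k - b k)) \<longlonglongrightarrow> 0"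
  proof (rule LIMSEQ_I)
    fix e :: real assume "e > 0"
    with key[of "e / 2"] obtain M where "\<forall>n\<ge>M. l2_norm (\<lambda>k. a n k - b k) \<le> e / 2"
      by auto
    with \<open>e > 0\<close> show "\<exists>M. \<forall>n\<ge>M. norm (l2_norm (\<lambda>k. a n k - b k) - 0) < e"
      by (intro exI[of _ M]) force
  qed
  with ssb show ?thesis
    by (rule that)
qed

text \<open>Rounding real and imaginary parts down to a grid of mesh \<open>1 / Suc n\<close> is
  uniformly close to the identity. This supplies the simple integrands for the spectral
  integral.\<close>

lemma uniform_limit_simple_functions:
  fixes K :: "complex set"
  assumes "bounded K"
  obtains s :: "nat \<Rightarrow> complex \<Rightarrow> complex"
  where "\<And>n. simple_function borel (s n)" "uniform_limit K s (\<lambda>z. z) sequentially"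
proof -
  obtain R where R: "\<And>z. z \<in> K \<Longrightarrow> cmod z \<le> R"
    using assms by (auto simp: bounded_iff)
  define q where "q n x = real_of_int \<lfloor>real (Suc n) * x\<rfloor> / real (Suc n)" for n x
  \<comment> \<open>A simple function on the whole plane must have finite range, so the rounding is
    cut off to 0 outside a disc containing \<open>K\<close>.\<close>
  define s where "s n z = (if cmod z \<le> R then Complex (q n (Re z)) (q n (Im z)) else 0)" for n z
  have q: "\<bar>q n x - x\<bar> \<le> 1 / real (Suc n)" for n x
  proof -
    have "\<bar>real_of_int \<lfloor>real (Suc n) * x\<rfloor> - real (Suc n) * x\<bar> \<le> 1"
      by linarith
    moreover have "q n x - x = (real_of_int \<lfloor>real (Suc n) * x\<rfloor> - real (Suc n) * x) / real (Suc n)"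
      unfolding q_def by (simp add: field_simps del: of_nat_Suc)
    ultimately show ?thesis
      by (simp add: divide_right_mono del: of_nat_Suc)
  qed
  have fin: "finite (q n ` {-R..R})" for n
  proof -
    have "(\<lambda>x. \<lfloor>real (Suc n) * x\<rfloor>) ` {-R..R} \<subseteq> {\<lfloor>real (Suc n) * - R\<rfloor>..\<lfloor>real (Suc n) * R\<rfloor>}"
    proof (rule image_subsetI)
      fix x assume "x \<in> {-R..R}"
      then have "real (Suc n) * - R \<le> real (Suc n) * x" "real (Suc n) * x \<le> real (Suc n) * R"
        by (intro mult_left_mono; simp)+
      then show "\<lfloor>real (Suc n) * x\<rfloor> \<in> {\<lfloor>real (Suc n) * - R\<rfloor>..\<lfloor>real (Suc n) * R\<rfloor>}"
        unfolding atLeastAtMost_iff by (intro conjI floor_mono)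
    qed
    then have "finite ((\<lambda>i. real_of_int i / real (Suc n)) ` (\<lambda>x. \<lfloor>real (Suc n) * x\<rfloor>) ` {-R..R})"
      by (rule finite_imageI[OF finite_subset]) simp
    then show ?thesis
      by (simp add: image_image q_def)
  qed
  show ?thesis
  proof (rule that)
    fix n
    have "s n ` space borel \<subseteq> insert 0 ((\<lambda>(x, y). Complex x y) ` (q n ` {-R..R} \<times> q n ` {-R..R}))"
    proof (rule image_subsetI)
      fix z :: complex
      show "s n z \<in> insert 0 ((\<lambda>(x, y). Complex x y) ` (q n ` {-R..R} \<times> q n ` {-R..R}))"
      proof (cases "cmod z \<le> R")
        case True
        then have "Re z \<in> {-R..R}" "Im z \<in> {-R..R}"
          using abs_Re_le_cmod[of z] abs_Im_le_cmod[of z] by auto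
        then have "(q n (Re z), q n (Im z)) \<in> q n ` {-R..R} \<times> q n ` {-R..R}"
          by blast
        then show ?thesis
          using True by (force simp: s_def)
      qed (simp add: s_def)
    qed
    then have "finite (s n ` space borel)"
      by (rule finite_subset) (intro finite.insertI finite_imageI finite_cartesian_product fin)
    moreover have "s n \<in> borel_measurable borel"
      unfolding s_def q_def Complex_eq by measurable
    ultimately show "simple_function borel (s n)"
      by (intro simple_function_borel_measurable)
  next
    show "uniform_limit K s (\<lambda>z. z) sequentially"
    proof (rule uniform_limitI)
      fix e :: real assume "e > 0"
      have "(\<lambda>n. 2 / real (Suc n)) \<longlonglongrightarrow> 0"
        using LIMSEQ_Suc[OF lim_const_over_n[of "2::real"]] .
      then have "\<forall>\<^sub>F n in sequentially. 2 / real (Suc n) < e"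
        using \<open>e > 0\<close> by (rule order_tendstoD)
      then show "\<forall>\<^sub>F n in sequentially. \<forall>z\<in>K. dist (s n z) z < e"
      proof eventually_elim
        case (elim n)
        show ?case
        proof
          fix z assume "z \<in> K"
          then have "Re (s n z - z) = q n (Re z) - Re z" "Im (s n z - z) = q n (Im z) - Im z"
            using R by (simp_all add: s_def)
          then have "dist (s n z) z \<le> \<bar>q n (Re z) - Re z\<bar> + \<bar>q n (Im z) - Im z\<bar>"
            using cmod_le[of "s n z - z"] by (simp only: dist_norm)
          also have "\<dots> \<le> 1 / real (Suc n) + 1 / real (Suc n)"
            by (intro add_mono q)
          also have "\<dots> = 2 / real (Suc n)"
            by (simp only: add_divide_distrib[symmetric] one_add_one)
          finally show "dist (s n z) z < e"
            using elim by simp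
        qed
      qed
    qed
  qed
qed

section \<open>Function spaces isometric to the square-summable families\<close>

locale l2_coordinates =
  fixes X :: "('x \<Rightarrow> complex) set" and N :: "('x \<Rightarrow> complex) \<Rightarrow> real"
    and J :: "('k \<Rightarrow> complex) \<Rightarrow> 'x \<Rightarrow> complex"
  assumes carrier: "X = J ` Collect square_summable"
    and J_add: "\<And>a b. square_summable a \<Longrightarrow> square_summable b \<Longrightarrow>
        J (\<lambda>k. a k + b k) = (\<lambda>x. J a x + J b x)"
    and J_scale: "\<And>a c. square_summable a \<Longrightarrow> J (\<lambda>k. c * a k) = (\<lambda>x. c * J a x)"
    and norm_J: "\<And>a. square_summable a \<Longrightarrow> N (J a) = l2_norm a"
begin

lemma J_in [simp]: "square_summable a \<Longrightarrow> J a \<in> X"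
  by (simp add: carrier)

lemma J_zero: "J (\<lambda>_. 0) = (\<lambda>_. 0)"
  using J_scale[of "\<lambda>_. 0" 0] by simp

lemma J_diff:
  assumes "square_summable a" "square_summable b"
  shows "J (\<lambda>k. a k - b k) = (\<lambda>x. J a x - J b x)"
  using J_add[OF assms(1) square_summable_scale(1)[OF assms(2), of "- 1"]] J_scale[OF assms(2), of "- 1"]
  by simp

lemma J_sum:
  assumes "\<And>i. i \<in> I \<Longrightarrow> square_summable (a i)"
  shows "square_summable (\<lambda>k. \<Sum>i\<in>I. a i k) \<and> J (\<lambda>k. \<Sum>i\<in>I. a i k) = (\<lambda>x. \<Sum>i\<in>I. J (a i) x)"
  using assms by (induction I rule: infinite_finite_induct) (auto simp: J_zero J_add square_summable_add)

text \<open>Injectivity is a consequence of linearity and \<open>norm_J\<close>: an isometry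
  annihilates only families of norm 0.\<close>

lemma J_eq_iff:
  assumes "square_summable a" "square_summable b"
  shows "J a = J b \<longleftrightarrow> a = b"
proof
  assume "J a = J b"
  then have "J (\<lambda>k. a k - b k) = J (\<lambda>_. 0)"
    by (simp add: J_diff assms J_zero)
  then have "l2_norm (\<lambda>k. a k - b k) = 0"
    by (metis norm_J assms l2_norm_zero square_summable_diff square_summable_zero)
  then show "a = b"
    using l2_norm_eq_0_iff[OF square_summable_diff[OF assms]] by (auto simp: fun_eq_iff)
qed simp

text \<open>The inverse of \<open>J\<close>. Outside \<open>X\<close> the description has no witness
  and its value is arbitrary.\<close>

definition coords :: "('x \<Rightarrow> complex) \<Rightarrow> 'k \<Rightarrow> complex" where
  "coords f = (THE a. square_summable a \<and> J a = f)"

lemma coords_J [simp]: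
  assumes "square_summable a"
  shows "coords (J a) = a"
  unfolding coords_def by (rule the_equality) (use assms J_eq_iff in auto)

lemma function_banach_space: "function_banach_space X N"
proof -
  have "\<exists>f\<in>X. (\<lambda>n. N (\<lambda>x. F n x - f x)) \<longlonglongrightarrow> 0"
    if F: "\<forall>n. F n \<in> X"
      and cauchy: "\<forall>\<epsilon>>0. \<exists>M. \<forall>m\<ge>M. \<forall>n\<ge>M. N (\<lambda>x. F m x - F n x) < \<epsilon>" for F :: "nat \<Rightarrow> _"
  proof -
    have "\<forall>n. \<exists>a. square_summable a \<and> F n = J a"
      using F carrier by auto
    then obtain a where a: "\<And>n. square_summable (a n)" "\<And>n. F n = J (a n)"
      by metis
    have diff: "N (\<lambda>x. J b x - J c x) = l2_norm (\<lambda>k. b k - c k)"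
      if "square_summable b" "square_summable c" for b c
      using that by (simp add: J_diff[symmetric] norm_J square_summable_diff)
    have "\<exists>M. \<forall>m\<ge>M. \<forall>n\<ge>M. l2_norm (\<lambda>k. a m k - a n k) < \<epsilon>" if "\<epsilon> > 0" for \<epsilon>
      using cauchy that by (simp add: a diff)
    then obtain b where "square_summable b" "(\<lambda>n. l2_norm (\<lambda>k. a n k - b k)) \<longlonglongrightarrow> 0"
      using l2_complete a(1) by blast
    then show ?thesis
      by (intro bexI[of _ "J b"]) (simp_all add: a diff)
  qed
  moreover have "(\<lambda>_. 0) \<in> X"
    using J_in[OF square_summable_zero] by (simp add: J_zero)
  ultimately show ?thesis
    unfolding function_banach_space_def
    by (auto simp: carrier J_add[symmetric] J_scale[symmetric] norm_J square_summable_add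
        square_summable_scale l2_norm_eq_0_iff J_zero J_eq_iff simp flip: J_zero)
qed

section \<open>Bounded diagonal operators\<close>

definition diag :: "('k \<Rightarrow> complex) \<Rightarrow> ('x \<Rightarrow> complex) \<Rightarrow> 'x \<Rightarrow> complex" where
  "diag m f = J (\<lambda>k. m k * coords f k)"

lemma diag_J [simp]: "square_summable a \<Longrightarrow> diag m (J a) = J (\<lambda>k. m k * a k)"
  by (simp add: diag_def)

lemma norm_diag_le:
  assumes "f \<in> X" "\<And>k. cmod (m k) \<le> C"
  shows "N (diag m f) \<le> C * N f"
proof -
  obtain a where a: "square_summable a" "f = J a"
    using assms(1) by (auto simp: carrier)
  then show ?thesis
    using square_summable_mult_bounded[of a m, OF a(1) assms(2)] by (simp add: norm_J)
qed

lemma bounded_operator_diag: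
  assumes "\<And>k. cmod (m k) \<le> C"
  shows "bounded_operator X N (diag m)"
  unfolding bounded_operator_def
proof (intro conjI ballI allI)
  fix f c assume "f \<in> X"
  then obtain a where a: "square_summable a" "f = J a"
    by (auto simp: carrier)
  note ma = square_summable_mult_bounded(1)[OF _ assms]
  show "diag m f \<in> X"
    by (simp add: a ma)
  show "diag m (\<lambda>x. c * f x) = (\<lambda>x. c * diag m f x)"
    by (simp add: a ma J_scale[symmetric] square_summable_scale mult.left_commute)
  fix g assume "g \<in> X"
  then obtain b where b: "square_summable b" "g = J b"
    by (auto simp: carrier)
  show "diag m (\<lambda>x. f x + g x) = (\<lambda>x. diag m f x + diag m g x)"
    by (simp add: a b ma J_add[symmetric] square_summable_add distrib_left)
next
  show "\<exists>M. \<forall>f\<in>X. N (diag m f) \<le> M * N f"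
    by (intro exI[of _ C] ballI norm_diag_le assms)
qed

text \<open>The conditions evaluate an operator at sums and multiples as well, so agreement on
  \<open>X\<close> transfers them because \<open>X\<close> is closed under both.\<close>

lemma bounded_operator_cong:
  assumes eq: "\<And>f. f \<in> X \<Longrightarrow> U f = V f" and V: "bounded_operator X N V"
  shows "bounded_operator X N U"
proof -
  have "(\<lambda>x. f x + g x) \<in> X" "(\<lambda>x. c * f x) \<in> X" if "f \<in> X" "g \<in> X" for f g c
    using that function_banach_space by (auto simp: function_banach_space_def)
  with V show ?thesis
    unfolding bounded_operator_def by (simp add: eq cong: ball_cong)
qed

section \<open>The spectral measure and the spectral integral of a diagonal operator\<close>

definition spectral_proj :: "('k \<Rightarrow> complex) \<Rightarrow> complex set \<Rightarrow> ('x \<Rightarrow> complex) \<Rightarrow> 'x \<Rightarrow> complex" where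
  "spectral_proj m A = diag (\<lambda>k. indicator A (m k))"

lemma cmod_indicator_le: "cmod (indicator A z) \<le> 1"
  by (simp add: indicator_def)

lemma spectral_proj_J:
  "square_summable a \<Longrightarrow> spectral_proj m A (J a) = J (\<lambda>k. indicator A (m k) * a k)"
  by (simp add: spectral_proj_def)

lemma square_summable_indicator:
  "square_summable a \<Longrightarrow> square_summable (\<lambda>k. indicator A (m k) * a k)"
  by (rule square_summable_mult_bounded(1)[OF _ cmod_indicator_le])

lemma spectral_proj_carrier:
  assumes "f \<in> X" "range m \<subseteq> A"
  shows "spectral_proj m A f = f"
proof -
  have "m k \<in> A" for k
    using assms(2) by auto
  then show ?thesis
    using assms(1) by (auto simp: carrier spectral_proj_J)
qed

text \<open>Finite additivity writes each partial sum as the total minus the contribution of a tail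
  union. The projections of a fixed \<open>f\<close> onto the tail unions tend to 0 in norm, hence
  also under a bounded functional.\<close>

lemma spectral_proj_sums:
  assumes disj: "disjoint_family A" and f: "f \<in> X" and l: "bounded_functional X N l"
  shows "(\<lambda>n::nat. l (spectral_proj m (A n) f)) sums l (spectral_proj m (\<Union>n. A n) f)"
proof -
  obtain a where a: "square_summable a" "f = J a"
    using f by (auto simp: carrier)
  obtain M where M: "\<And>f. f \<in> X \<Longrightarrow> cmod (l f) \<le> M * N f"
    using l unfolding bounded_functional_def by blast
  have l_add: "l (\<lambda>x. f x + g x) = l f + l g" if "f \<in> X" "g \<in> X" for f g
    using l that by (auto simp: bounded_functional_def)
  define P where "P S = J (\<lambda>k. indicator S (m k) * a k)" for S
  have PX: "P S \<in> X" for S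
    by (simp add: P_def square_summable_indicator a)
  have P_Un: "l (P (S \<union> T)) = l (P S) + l (P T)" if "S \<inter> T = {}" for S T
  proof -
    have "(\<lambda>k. indicator (S \<union> T) (m k) * a k)
        = (\<lambda>k. indicator S (m k) * a k + indicator T (m k) * a k)"
      using that by (auto simp: fun_eq_iff indicator_def)
    then have "P (S \<union> T) = (\<lambda>x. P S x + P T x)"
      by (simp add: P_def J_add square_summable_indicator a)
    then show ?thesis
      by (simp add: l_add PX)
  qed
  have "P {} = (\<lambda>_. 0)"
    by (simp add: P_def J_zero)
  then have P_empty: "l (P {}) = 0"
    using l_add[OF PX PX, of "{}" "{}"] by simp
  have split: "l (P (\<Union>n. A n)) = (\<Sum>i<n. l (P (A i))) + l (P (\<Union>i\<in>{n..}. A i))" for n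
  proof (induction n)
    case 0
    then show ?case by simp
  next
    case (Suc n)
    have "A n \<inter> A i = {}" if "Suc n \<le> i" for i
      using disj that by (simp add: disjoint_family_on_def)
    then have "A n \<inter> (\<Union>i\<in>{Suc n..}. A i) = {}"
      by fastforce
    moreover have "{n..} = insert n {Suc n..}"
      by auto
    then have "(\<Union>i\<in>{n..}. A i) = A n \<union> (\<Union>i\<in>{Suc n..}. A i)"
      by simp
    ultimately show ?case
      by (simp add: Suc.IH P_Un)
  qed
  have "(\<lambda>n. N (P (\<Union>i\<in>{n..}. A i))) \<longlonglongrightarrow> 0"
  proof (rule LIMSEQ_I)
    fix e :: real assume "e > 0"
    then obtain F where F: "finite F"
      "\<And>m. \<lbrakk>\<And>k. cmod (m k) \<le> 1; \<And>k. k \<in> F \<Longrightarrow> m k = 0\<rbrakk> \<Longrightarrow> l2_norm (\<lambda>k. m k * a k) \<le> e / 2"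
      using l2_norm_tail[OF a(1), of "e / 2"] by auto
    \<comment> \<open>By disjointness a point lies in at most one \<open>A i\<close>, so it leaves
      the tail unions eventually. Finiteness of \<open>F\<close> then gives a common
      threshold.\<close>
    have ev: "\<forall>\<^sub>F n in sequentially. m k \<notin> (\<Union>i\<in>{n..}. A i)" for k
    proof (cases "\<exists>i. m k \<in> A i")
      case True
      then obtain i where i: "m k \<in> A i" by blast
      have "m k \<notin> A j" if "i < j" for j
        using disj i that by (metis UNIV_I disjoint_family_onD disjoint_iff order_less_irrefl)
      then have "m k \<notin> (\<Union>j\<in>{n..}. A j)" if "n > i" for n
        using that by auto
      then show ?thesis
        using eventually_gt_at_top by (rule eventually_mono[rotated])
    qed auto
    have "\<forall>\<^sub>F n in sequentially. \<forall>k\<in>F. m k \<notin> (\<Union>i\<in>{n..}. A i)"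
      by (rule eventually_ball_finite[OF F(1)]) (use ev in blast)
    then obtain n0 where n0: "\<And>n. n \<ge> n0 \<Longrightarrow> \<forall>k\<in>F. m k \<notin> (\<Union>i\<in>{n..}. A i)"
      by (auto simp: eventually_sequentially)
    have small: "N (P (\<Union>i\<in>{n..}. A i)) \<le> e / 2" if "n \<ge> n0" for n
    proof -
      have "l2_norm (\<lambda>k. indicator (\<Union>i\<in>{n..}. A i) (m k) * a k) \<le> e / 2"
        by (rule F(2)[OF cmod_indicator_le]) (use n0[OF that] in \<open>auto simp: indicator_def\<close>)
      then show ?thesis
        by (simp add: P_def norm_J square_summable_indicator a)
    qed
    have pos: "0 \<le> N (P S)" for S
      by (simp add: P_def norm_J square_summable_indicator a)
    show "\<exists>no. \<forall>n\<ge>no. norm (N (P (\<Union>i\<in>{n..}. A i)) - 0) < e"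
    proof (intro exI[of _ n0] allI impI)
      fix n assume "n0 \<le> n"
      from small[OF this] pos[of "\<Union>i\<in>{n..}. A i"] \<open>e > 0\<close>
      show "norm (N (P (\<Union>i\<in>{n..}. A i)) - 0) < e"
        by simp
    qed
  qed
  then have lim: "(\<lambda>n. M * N (P (\<Union>i\<in>{n..}. A i))) \<longlonglongrightarrow> 0"
    by (rule tendsto_mult_right_zero)
  have tail: "(\<lambda>n. l (P (\<Union>i\<in>{n..}. A i))) \<longlonglongrightarrow> 0"
    by (rule Lim_null_comparison[OF _ lim]) (simp add: M PX)
  have "(\<lambda>n. l (P (\<Union>n. A n)) - l (P (\<Union>i\<in>{n..}. A i))) \<longlonglongrightarrow> l (P (\<Union>n. A n)) - 0"
    by (intro tendsto_intros tail)
  moreover have "(\<lambda>n. l (P (\<Union>n. A n)) - l (P (\<Union>i\<in>{n..}. A i))) = (\<lambda>n. \<Sum>i<n. l (P (A i)))"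
    by (rule ext) (metis split add_diff_cancel_right')
  ultimately have "(\<lambda>n. l (P (A n))) sums l (P (\<Union>n. A n))"
    by (simp add: sums_def)
  then show ?thesis
    by (simp only: a spectral_proj_J P_def)
qed

text \<open>Multiplicativity is that of indicator functions, the uniform bound is 1, and the closure
  of the bounded set of entries is a compact carrier.\<close>

lemma spectral_measure_spectral_proj:
  assumes "bounded (range m)"
  shows "spectral_measure X N (spectral_proj m)"
  unfolding spectral_measure_def
proof (intro conjI ballI allI impI)
  fix S T :: "complex set" and f
  assume "f \<in> X"
  then show "spectral_proj m (S \<inter> T) f = spectral_proj m S (spectral_proj m T f)"
    by (auto simp: carrier spectral_proj_J square_summable_indicator indicator_inter_arith mult.assoc)
next
  show "\<exists>K. compact K \<and> (\<forall>f\<in>X. spectral_proj m K f = f)"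
    using assms compact_closure closure_subset spectral_proj_carrier by metis
next
  show "\<exists>M. \<forall>S\<in>sets borel. \<forall>f\<in>X. N (spectral_proj m S f) \<le> M * N f"
    unfolding spectral_proj_def
    by (intro exI[of _ 1] ballI norm_diag_le cmod_indicator_le)
next
  show "bounded_operator X N (spectral_proj m S)" for S
    unfolding spectral_proj_def by (rule bounded_operator_diag) (rule cmod_indicator_le)
qed (auto simp: spectral_proj_carrier intro: spectral_proj_sums)

text \<open>In coordinate \<open>k\<close> the indicators select the single term with
  \<open>c = s (m k)\<close>, so the finite sum collapses.\<close>

lemma simple_spectral_integral_proj:
  assumes "finite (range s)" "f \<in> X"
  shows "simple_spectral_integral (spectral_proj m) s f = diag (s \<circ> m) f"
proof -
  obtain a where a: "square_summable a" "f = J a"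
    using assms by (auto simp: carrier)
  have "simple_spectral_integral (spectral_proj m) s f
      = (\<lambda>x. \<Sum>c\<in>range s. J (\<lambda>k. c * (indicator (s -` {c}) (m k) * a k)) x)"
    by (simp add: simple_spectral_integral_def a spectral_proj_J J_scale square_summable_indicator)
  also have "\<dots> = J (\<lambda>k. \<Sum>c\<in>range s. c * (indicator (s -` {c}) (m k) * a k))"
    by (rule J_sum[THEN conjunct2, symmetric]) (intro square_summable_scale square_summable_indicator a)
  also have "(\<lambda>k. \<Sum>c\<in>range s. c * (indicator (s -` {c}) (m k) * a k)) = (\<lambda>k. s (m k) * a k)"
  proof
    fix k
    have "(\<Sum>c\<in>range s. c * (indicator (s -` {c}) (m k) * a k))
        = (\<Sum>c\<in>range s. if c = s (m k) then s (m k) * a k else 0)"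
      by (intro sum.cong) (auto simp: indicator_def)
    then show "(\<Sum>c\<in>range s. c * (indicator (s -` {c}) (m k) * a k)) = s (m k) * a k"
      using assms(1) by simp
  qed
  finally show ?thesis
    by (simp add: a)
qed

text \<open>The difference of two diagonal operators is again diagonal, and its norm is at most the
  supremum of its entries. Uniform convergence of \<open>s n\<close> on the closure of the entries
  therefore gives convergence in operator norm.\<close>

lemma has_spectral_integral_diag:
  assumes "bounded (range m)" and U: "\<And>f. f \<in> X \<Longrightarrow> U f = diag m f"
  shows "has_spectral_integral X N (spectral_proj m) (\<lambda>z. z) U"
proof -
  let ?K = "closure (range m)"
  have K: "compact ?K"
    using assms(1) by (simp add: compact_closure)
  obtain C where C: "\<And>k. cmod (m k) \<le> C"
    using assms(1) by (auto simp: bounded_iff)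
  obtain s where s: "\<And>n. simple_function borel (s n)" "uniform_limit ?K s (\<lambda>z. z) sequentially"
    using uniform_limit_simple_functions[OF compact_imp_bounded[OF K]] by blast
  have fin: "finite (range (s n))" for n
    using s(1)[of n] by (simp add: simple_function_def)
  have "\<forall>\<^sub>F n in sequentially. \<forall>f\<in>X.
      N (\<lambda>x. simple_spectral_integral (spectral_proj m) (s n) f x - U f x) \<le> \<epsilon> * N f"
    if "\<epsilon> > 0" for \<epsilon>
    using uniform_limitD[OF s(2) that]
  proof eventually_elim
    case (elim n)
    have d: "cmod (s n (m k) - m k) \<le> \<epsilon>" for k
      using elim closure_subset[of "range m"] by (metis dist_norm less_imp_le rangeI subsetD)
    obtain D where D: "\<And>z. cmod (s n z) \<le> D"
      using finite_imp_bounded[OF fin[of n]] by (auto simp: bounded_iff)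
    show ?case
    proof
      fix f assume f: "f \<in> X"
      then obtain a where a: "square_summable a" "f = J a"
        by (auto simp: carrier)
      have sm: "square_summable (\<lambda>k. s n (m k) * a k)" "square_summable (\<lambda>k. m k * a k)"
        by (rule square_summable_mult_bounded(1)[OF a(1)], rule D C)+
      have "(\<lambda>x. diag (s n \<circ> m) f x - diag m f x) = diag (\<lambda>k. s n (m k) - m k) f"
        by (simp add: a J_diff sm left_diff_distrib)
      with norm_diag_le[OF f d]
      show "N (\<lambda>x. simple_spectral_integral (spectral_proj m) (s n) f x - U f x) \<le> \<epsilon> * N f"
        by (simp add: simple_spectral_integral_proj fin f U)
    qed
  qed
  then show ?thesis
    unfolding has_spectral_integral_def
    using K s spectral_proj_carrier[OF _ closure_subset] by blast
qed

lemma scalar_type_diag: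
  assumes "bounded (range m)" and U: "\<And>f. f \<in> X \<Longrightarrow> U f = diag m f"
  shows "scalar_type_spectral_operator X N U"
proof -
  obtain C where C: "\<And>k. cmod (m k) \<le> C"
    using assms(1) by (auto simp: bounded_iff)
  have "bounded_operator X N U"
    by (rule bounded_operator_cong[OF U bounded_operator_diag[OF C]])
  then show ?thesis
    unfolding scalar_type_spectral_operator_def
    using function_banach_space spectral_measure_spectral_proj[OF assms(1)]
      has_spectral_integral_diag[OF assms] by blast
qed

text \<open>Off the closure the numbers \<open>\<xi> - m k\<close> stay away from 0, and their
  reciprocals form a bounded diagonal inverse. Conversely, a continuous inverse keeps
  \<open>\<xi>\<close> at a positive distance from every entry, as the unit vectors show.\<close>

lemma op_spectrum_diag:
  assumes "bounded (range m)" and U: "\<And>f. f \<in> X \<Longrightarrow> U f = diag m f"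
  shows "op_spectrum X N U = closure (range m)"
proof -
  obtain C where C: "\<And>k. cmod (m k) \<le> C"
    using assms(1) by (auto simp: bounded_iff)
  have "\<xi> \<in> resolvent_set X N U \<longleftrightarrow> \<xi> \<notin> closure (range m)" for \<xi>
  proof -
    define T where "T = (\<lambda>f x. \<xi> * f x - U f x)"
    have mem: "\<xi> \<in> resolvent_set X N U \<longleftrightarrow>
       (\<forall>f\<in>X. \<forall>\<epsilon>>0. \<exists>g\<in>T ` X. N (\<lambda>x. f x - g x) < \<epsilon>) \<and>
       inj_on T X \<and>
       (\<forall>f\<in>T ` X. \<forall>\<epsilon>>0. \<exists>\<delta>>0. \<forall>g\<in>T ` X. N (\<lambda>x. g x - f x) < \<delta> \<longrightarrow>
          N (\<lambda>x. inv_into X T g x - inv_into X T f x) < \<epsilon>)"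
      by (simp add: resolvent_set_def T_def Let_def)
    have ss_m: "square_summable (\<lambda>k. m k * a k)" if "square_summable a" for a
      by (rule square_summable_mult_bounded(1)[OF that]) (rule C)
    have TJ: "T (J a) = J (\<lambda>k. (\<xi> - m k) * a k)" if "square_summable a" for a
      using that by (simp add: T_def U J_scale J_diff square_summable_scale ss_m left_diff_distrib)
    have TC: "cmod (\<xi> - m k) \<le> cmod \<xi> + C" for k
      using norm_triangle_ineq4[of \<xi> "m k"] C[of k] by linarith
    have ss_T: "square_summable (\<lambda>k. (\<xi> - m k) * a k)" if "square_summable a" for a
      by (rule square_summable_mult_bounded(1)[OF that]) (rule TC)
    show ?thesis
    proof
      assume "\<xi> \<notin> closure (range m)"
      then obtain d where d: "d > 0" "\<And>k. cmod (\<xi> - m k) \<ge> d"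
        unfolding closure_approachable by (metis dist_commute dist_norm not_less rangeI)
      have inv: "cmod (inverse (\<xi> - m k)) \<le> inverse d" for k
        using d by (simp add: norm_inverse le_imp_inverse_le)
      have ss_inv: "square_summable (\<lambda>k. inverse (\<xi> - m k) * a k)" if "square_summable a" for a
        by (rule square_summable_mult_bounded(1)[OF that]) (rule inv)
      have nz: "\<xi> \<noteq> m k" for k
        using d by (metis norm_zero not_less right_minus_eq)
      define R where "R = diag (\<lambda>k. inverse (\<xi> - m k))"
      have RX: "R f \<in> X" if "f \<in> X" for f
        using that by (auto simp: carrier R_def ss_inv)
      have RT: "R (T f) = f" if "f \<in> X" for f
        using that nz
        by (auto simp: carrier R_def TJ ss_T mult.assoc[symmetric])
      have TR: "T (R f) = f" if "f \<in> X" for f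
        using that nz
        by (auto simp: carrier R_def TJ ss_inv mult.assoc[symmetric])
      have TX: "T f \<in> X" if "f \<in> X" for f
        using that by (auto simp: carrier TJ ss_T)
      \<comment> \<open>Surjectivity settles the density clause and lets the continuity clause range
        over all of \<open>X\<close>.\<close>
      have im: "T ` X = X"
        using TX TR RX by (metis image_subsetI subsetI subset_antisym rev_image_eqI)
      have inj: "inj_on T X"
        by (rule inj_on_inverseI) (rule RT)
      have invT: "inv_into X T f = R f" if "f \<in> X" for f
        using that by (metis RX TR inj inv_into_f_f)
      have N0: "N (\<lambda>x. f x - f x) = 0" for f
        using norm_J[of "\<lambda>_. 0"] by (simp add: J_zero)
      have R_diff: "(\<lambda>x. R g x - R f x) = R (\<lambda>x. g x - f x)" "(\<lambda>x. g x - f x) \<in> X"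
        if "f \<in> X" "g \<in> X" for f g
        using that
        by (auto simp: carrier R_def J_diff[symmetric] square_summable_diff
            ss_inv right_diff_distrib)
      show "\<xi> \<in> resolvent_set X N U"
        unfolding mem im
      proof (intro conjI ballI allI impI inj)
        fix f and \<epsilon> :: real assume "f \<in> X" "\<epsilon> > 0"
        then show "\<exists>g\<in>X. N (\<lambda>x. f x - g x) < \<epsilon>"
          using N0 by metis
        show "\<exists>\<delta>>0. \<forall>g\<in>X. N (\<lambda>x. g x - f x) < \<delta> \<longrightarrow>
          N (\<lambda>x. inv_into X T g x - inv_into X T f x) < \<epsilon>"
        proof (intro exI[of _ "d * \<epsilon>"] conjI ballI impI)
          show "d * \<epsilon> > 0"
            using d \<open>\<epsilon> > 0\<close> by simp
          fix g assume g: "g \<in> X" "N (\<lambda>x. g x - f x) < d * \<epsilon>"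
          have "N (\<lambda>x. inv_into X T g x - inv_into X T f x) = N (R (\<lambda>x. g x - f x))"
            using \<open>f \<in> X\<close> g by (simp add: invT R_diff)
          also have "\<dots> \<le> inverse d * N (\<lambda>x. g x - f x)"
            unfolding R_def by (rule norm_diag_le[OF _ inv]) (use R_diff \<open>f \<in> X\<close> g in auto)
          also have "\<dots> < \<epsilon>"
            using g(2) d by (simp add: field_simps)
          finally show "N (\<lambda>x. inv_into X T g x - inv_into X T f x) < \<epsilon>" .
        qed
      qed
    next
      assume "\<xi> \<in> resolvent_set X N U"
      then have inj: "inj_on T X"
        and cont: "\<forall>f\<in>T ` X. \<forall>\<epsilon>>0. \<exists>\<delta>>0. \<forall>g\<in>T ` X. N (\<lambda>x. g x - f x) < \<delta> \<longrightarrow>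
          N (\<lambda>x. inv_into X T g x - inv_into X T f x) < \<epsilon>"
        unfolding mem by blast+
      have zX: "(\<lambda>_. 0) \<in> X"
        using J_in[OF square_summable_zero] by (simp add: J_zero)
      have T0: "T (\<lambda>_. 0) = (\<lambda>_. 0)"
        using TJ[of "\<lambda>_. 0"] by (simp add: J_zero)
      \<comment> \<open>Continuity of the inverse at 0 with tolerance 1, which is the norm of a unit
        vector.\<close>
      obtain \<delta> where \<delta>: "\<delta> > 0"
        "\<And>g. g \<in> T ` X \<Longrightarrow> N g < \<delta> \<Longrightarrow> N (inv_into X T g) < 1"
        using cont[rule_format, of "\<lambda>_. 0" 1] inv_into_f_f[OF inj zX] T0 zX image_eqI[of _ T, OF _ zX]
        by auto
      have "cmod (\<xi> - m i) \<ge> \<delta>" for i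
      proof (rule ccontr)
        assume less: "\<not> cmod (\<xi> - m i) \<ge> \<delta>"
        \<comment> \<open>The image of the unit vector at \<open>i\<close> has norm
          \<open>cmod (\<xi> - m i)\<close>. If this were below \<delta>, the unit vector would have
          norm below 1.\<close>
        let ?e = "\<lambda>k. if k = i then 1 else 0"
        have "T (J ?e) = J (\<lambda>k. if k = i then \<xi> - m i else 0)"
          by (subst TJ[OF square_summable_unit]) (auto intro!: arg_cong[of _ _ J])
        then have "N (T (J ?e)) = cmod (\<xi> - m i)"
          by (simp add: norm_J square_summable_unit l2_norm_unit)
        with less \<delta>(2)[of "T (J ?e)"] have "N (J ?e) < 1"
          using inj by (simp add: inv_into_f_f square_summable_unit)
        then show False
          by (simp add: norm_J square_summable_unit l2_norm_unit)
      qed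
      then show "\<xi> \<notin> closure (range m)"
        unfolding closure_approachable using \<delta>(1)
        by (metis dist_commute dist_norm imageE not_less)
    qed
  qed
  then show ?thesis
    by (auto simp: op_spectrum_def)
qed

end

section \<open>Power series in several variables\<close>

text \<open>A finite set of multi-indices lies in a box, and over a box the sum factors into
  truncated geometric series.\<close>

lemma summable_multi_geometric:
  fixes x :: "'n::finite \<Rightarrow> real"
  assumes "\<And>j. 0 \<le> x j" "\<And>j. x j < 1"
  shows "(\<lambda>k::'n \<Rightarrow> nat. \<Prod>j\<in>UNIV. x j ^ k j) summable_on UNIV"
proof (rule nonneg_bdd_above_summable_on)
  show "bdd_above (sum (\<lambda>k. \<Prod>j\<in>UNIV. x j ^ k j) ` {F. F \<subseteq> UNIV \<and> finite F})"
  proof (rule bdd_aboveI2)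
    fix F :: "('n \<Rightarrow> nat) set" assume "F \<in> {F. F \<subseteq> UNIV \<and> finite F}"
    then have F: "finite F" by simp
    \<comment> \<open>A common bound for all exponents in \<open>F\<close>; inserting 0 keeps the
      maximum meaningful for empty \<open>F\<close>.\<close>
    define M where "M = Max (insert 0 ((\<lambda>(k, j). k j) ` (F \<times> UNIV)))"
    have M: "k j \<le> M" if "k \<in> F" for k j
      unfolding M_def using F that by (intro Max_ge) force+
    have "(\<Sum>k\<in>F. \<Prod>j\<in>UNIV. x j ^ k j) \<le> (\<Sum>k\<in>UNIV \<rightarrow>\<^sub>E {..M}. \<Prod>j\<in>UNIV. x j ^ k j)"
      by (rule sum_mono2) (use M assms in \<open>auto intro!: finite_PiE prod_nonneg\<close>)
    also have "\<dots> = (\<Prod>j\<in>UNIV. \<Sum>i\<le>M. x j ^ i)"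
      by (rule prod_sum_PiE[symmetric]) auto
    also have "\<dots> \<le> (\<Prod>j\<in>UNIV. 1 / (1 - x j))"
    proof (rule prod_mono)
      fix j
      have "(\<Sum>i\<le>M. x j ^ i) \<le> (\<Sum>i. x j ^ i)"
        by (rule sum_le_suminf) (use assms in \<open>auto intro!: summable_geometric\<close>)
      also have "\<dots> = 1 / (1 - x j)"
        by (rule suminf_geometric) (use assms in auto)
      finally show "0 \<le> (\<Sum>i\<le>M. x j ^ i) \<and> (\<Sum>i\<le>M. x j ^ i) \<le> 1 / (1 - x j)"
        using assms by (auto intro: sum_nonneg)
    qed
    finally show "(\<Sum>k\<in>F. \<Prod>j\<in>UNIV. x j ^ k j) \<le> (\<Prod>j\<in>UNIV. 1 / (1 - x j))" .
  qed
qed (use assms in \<open>auto intro: prod_nonneg\<close>)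

text \<open>By the inequality between a product and the sum of two squares, each term is dominated
  by \<open>(cmod (\<alpha> k))\<close> squared plus a term of the geometric series in the squared
  moduli of \<open>z\<close>.\<close>

lemma abs_summable_multi_power_series:
  fixes z :: "'n::finite \<Rightarrow> complex"
  assumes "square_summable \<alpha>" "\<And>j. cmod (z j) < 1"
  shows "(\<lambda>k. norm (\<alpha> k * (\<Prod>j\<in>UNIV. z j ^ k j))) summable_on UNIV"
proof -
  have "(\<lambda>k::'n \<Rightarrow> nat. \<Prod>j\<in>UNIV. ((cmod (z j))\<^sup>2) ^ k j) summable_on UNIV"
    by (rule summable_multi_geometric) (use assms in \<open>auto simp: abs_square_less_1\<close>)
  then have "(\<lambda>k. (cmod (\<alpha> k))\<^sup>2 + (\<Prod>j\<in>UNIV. ((cmod (z j))\<^sup>2) ^ k j)) summable_on UNIV"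
    using assms(1) by (intro summable_on_add) (auto simp: square_summable_def)
  then show ?thesis
  proof (rule summable_on_comparison_test)
    fix k
    have "2 * (cmod (\<alpha> k) * (\<Prod>j\<in>UNIV. cmod (z j) ^ k j))
        \<le> (cmod (\<alpha> k))\<^sup>2 + (\<Prod>j\<in>UNIV. cmod (z j) ^ k j)\<^sup>2"
      using sum_squares_bound[of "cmod (\<alpha> k)" "\<Prod>j\<in>UNIV. cmod (z j) ^ k j"] by simp
    moreover have "0 \<le> cmod (\<alpha> k) * (\<Prod>j\<in>UNIV. cmod (z j) ^ k j)"
      by (intro mult_nonneg_nonneg prod_nonneg) auto
    moreover have "(\<Prod>j\<in>UNIV. cmod (z j) ^ k j)\<^sup>2 = (\<Prod>j\<in>UNIV. ((cmod (z j))\<^sup>2) ^ k j)"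
      by (simp only: prod_power_distrib power_mult[symmetric] mult.commute)
    moreover have "norm (\<alpha> k * (\<Prod>j\<in>UNIV. z j ^ k j)) = cmod (\<alpha> k) * (\<Prod>j\<in>UNIV. cmod (z j) ^ k j)"
      by (simp add: norm_mult norm_power prod_norm[symmetric])
    ultimately show "norm (\<alpha> k * (\<Prod>j\<in>UNIV. z j ^ k j))
        \<le> (cmod (\<alpha> k))\<^sup>2 + (\<Prod>j\<in>UNIV. ((cmod (z j))\<^sup>2) ^ k j)"
      by linarith
  qed auto
qed

section \<open>Uniqueness of the coefficients of a power series in several variables\<close>

lemma finite_multi_index_le: "finite {k :: 'n::finite \<Rightarrow> nat. (\<Sum>j\<in>UNIV. k j) \<le> m}"
proof (rule finite_subset)
  have "k j \<le> (\<Sum>j\<in>UNIV. k j)" for k :: "'n \<Rightarrow> nat" and j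
    by (rule member_le_sum) auto
  then show "{k :: 'n \<Rightarrow> nat. (\<Sum>j\<in>UNIV. k j) \<le> m} \<subseteq> UNIV \<rightarrow>\<^sub>E {..m}"
    by (auto intro: order_trans)
qed (auto intro: finite_PiE)

text \<open>Orthogonality of the characters of the cyclic group of order \<open>N\<close>. The
  summands are powers of an \<open>N\<close>-th root of unity \<open>u\<close>, which is 1 only if
  \<open>N\<close> divides the difference of \<open>a\<close> and \<open>b\<close>; both being below
  \<open>N\<close>, they then coincide.\<close>

lemma sum_powers_root_of_unity:
  fixes N a b :: nat
  assumes "a < N" "b < N"
  shows "(\<Sum>r<N. cis (2 * pi / N) ^ (r * a) * cnj (cis (2 * pi / N)) ^ (r * b)) = (if a = b then of_nat N else 0)"
proof -
  have N: "N > 0"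
    using assms by simp
  define u where "u = cis (2 * pi * (real a - real b) / N)"
  have u: "cis (2 * pi / N) ^ (r * a) * cnj (cis (2 * pi / N)) ^ (r * b) = u ^ r" for r
  proof -
    have "cis (2 * pi / N) ^ (r * a) * cnj (cis (2 * pi / N)) ^ (r * b)
        = cis (real (r * a) * (2 * pi / N) + - (real (r * b) * (2 * pi / N)))"
      by (simp add: Complex.DeMoivre cis_cnj cis_mult del: of_nat_mult)
    also have "\<dots> = u ^ r"
      unfolding u_def Complex.DeMoivre
      by (rule arg_cong[of _ _ cis]) (simp add: diff_divide_distrib algebra_simps)
    finally show ?thesis .
  qed
  have "u ^ N = cis (2 * pi * of_int (int a - int b))"
    unfolding u_def Complex.DeMoivre using N by (intro arg_cong[of _ _ cis]) (simp add: field_simps)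
  also have "\<dots> = 1"
    by (rule cis_multiple_2pi) auto
  finally have uN: "u ^ N = 1" .
  show ?thesis
  proof (cases "a = b")
    case True
    then have "u = 1"
      by (simp add: u_def)
    then show ?thesis
      unfolding u using True by simp
  next
    case False
    have "u \<noteq> 1"
    proof
      assume "u = 1"
      then have "cos (2 * pi * (real a - real b) / N) = 1"
        unfolding u_def by (metis cis.simps(1) one_complex.simps(1))
      then obtain n where n: "2 * pi * (real a - real b) / N = real_of_int n * 2 * pi"
        unfolding cos_one_2pi_int by blast
      have "2 * pi * (real a - real b) = 2 * pi * (real_of_int n * N)"
        using n N by (simp add: field_simps)
      then have "real a - real b = real_of_int n * N"
        by simp
      then have "real_of_int (int a - int b) = real_of_int (n * int N)"
        by simp
      then have "int a - int b = n * int N"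
        by (simp only: of_int_eq_iff)
      then have "int N dvd int a - int b"
        by simp
      then have "int N \<le> \<bar>int a - int b\<bar>"
        using False by (intro zdvd_imp_le) (auto simp: dvd_abs_iff)
      then show False
        using assms by linarith
    qed
    then show ?thesis
      using False uN by (simp add: u geometric_sum)
  qed
qed

text \<open>Coefficients of a polynomial are recovered by averaging against characters over a finite torus.\<close>

lemma multi_polynomial_coeffs_zero:
  fixes \<alpha> :: "('n::finite \<Rightarrow> nat) \<Rightarrow> complex"
  assumes S: "finite S" and zero: "\<And>z. (\<Sum>k\<in>S. \<alpha> k * (\<Prod>j\<in>UNIV. z j ^ k j)) = 0"
    and l: "l \<in> S"
  shows "\<alpha> l = 0"
proof -
  \<comment> \<open>Strictly larger than every exponent in \<open>S\<close>, so that distinct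
    exponents stay distinct modulo \<open>N\<close>.\<close>
  define N where "N = Suc (Max ((\<lambda>(k, j). k j) ` (S \<times> UNIV)))"
  have kN: "k j < N" if "k \<in> S" for k j
    unfolding N_def less_Suc_eq_le using S that by (intro Max_ge) force+
  define \<omega> where "\<omega> = cis (2 * pi / N)"
  have "0 = (\<Sum>r\<in>UNIV \<rightarrow>\<^sub>E {..<N}. (\<Prod>j\<in>UNIV. cnj \<omega> ^ (r j * l j)) *
      (\<Sum>k\<in>S. \<alpha> k * (\<Prod>j\<in>UNIV. (\<omega> ^ r j) ^ k j)))"
    by (simp add: zero)
  also have "\<dots> = (\<Sum>k\<in>S. \<alpha> k * (\<Sum>r\<in>UNIV \<rightarrow>\<^sub>E {..<N}.
      \<Prod>j\<in>UNIV. \<omega> ^ (r j * k j) * cnj \<omega> ^ (r j * l j)))"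
    unfolding sum_distrib_left
    by (subst sum.swap) (simp add: prod.distrib power_mult mult_ac)
  also have "\<dots> = (\<Sum>k\<in>S. \<alpha> k * (\<Prod>j\<in>UNIV. \<Sum>r<N. \<omega> ^ (r * k j) * cnj \<omega> ^ (r * l j)))"
    by (subst prod_sum_PiE) auto
  also have "\<dots> = (\<Sum>k\<in>S. if k = l then \<alpha> l * of_nat N ^ CARD('n) else 0)"
  proof (rule sum.cong)
    fix k assume k: "k \<in> S"
    have eq: "(\<Prod>j\<in>UNIV. \<Sum>r<N. \<omega> ^ (r * k j) * cnj \<omega> ^ (r * l j))
        = (\<Prod>j\<in>UNIV. if k j = l j then of_nat N else 0)"
      unfolding \<omega>_def by (intro prod.cong refl sum_powers_root_of_unity kN k l)
    show "\<alpha> k * (\<Prod>j\<in>UNIV. \<Sum>r<N. \<omega> ^ (r * k j) * cnj \<omega> ^ (r * l j))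
        = (if k = l then \<alpha> l * of_nat N ^ CARD('n) else 0)"
    proof (cases "k = l")
      case False
      then obtain j where "k j \<noteq> l j" by auto
      then have "(\<Prod>j\<in>UNIV. if k j = l j then of_nat N else (0 :: complex)) = 0"
        by (intro prod_zero) auto
      with False show ?thesis
        unfolding eq by simp
    next
      case True
      then show ?thesis
        unfolding eq by simp
    qed
  qed simp
  also have "\<dots> = \<alpha> l * of_nat N ^ CARD('n)"
    using S l by simp
  finally have "\<alpha> l * of_nat N ^ CARD('n) = 0"
    by simp
  moreover have "N \<noteq> 0"
    by (simp add: N_def)
  ultimately show ?thesis
    by simp
qed

text \<open>The coordinates are released from the reals one at a time. In a single complex
  coordinate the sum is a polynomial with infinitely many real roots, hence zero.\<close>

lemma polynomial_zero_on_complexification: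
  fixes L :: "complex^'n \<Rightarrow> 'm::finite \<Rightarrow> complex" and \<alpha> :: "('m \<Rightarrow> nat) \<Rightarrow> complex"
  assumes add: "\<And>x y j. L (x + y) j = L x j + L y j"
    and scale: "\<And>c x j. L (c *s x) j = c * L x j"
    and zero: "\<And>y. (\<And>i. y $ i \<in> \<real>) \<Longrightarrow> (\<Sum>k\<in>S. \<alpha> k * (\<Prod>j\<in>UNIV. L y j ^ k j)) = 0"
  shows "(\<Sum>k\<in>S. \<alpha> k * (\<Prod>j\<in>UNIV. L y j ^ k j)) = 0"
proof -
  have "\<forall>y. (\<forall>i. i \<notin> I \<longrightarrow> y $ i \<in> \<real>) \<longrightarrow> (\<Sum>k\<in>S. \<alpha> k * (\<Prod>j\<in>UNIV. L y j ^ k j)) = 0"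
    if "finite I" for I :: "'n set"
    using that
  proof (induction I)
    case empty
    then show ?case using zero by simp
  next
    case (insert i I)
    show ?case
    proof (intro allI impI)
      fix y :: "complex^'n" assume y: "\<forall>i'. i' \<notin> insert i I \<longrightarrow> y $ i' \<in> \<real>"
      define x where "x = (\<chi> i'. if i' = i then 0 else y $ i')"
      have x: "x + t *s axis i 1 = (\<chi> i'. if i' = i then t else y $ i')" for t
        by (simp add: x_def vec_eq_iff axis_def)
      define p where "p = (\<Sum>k\<in>S. smult (\<alpha> k) (\<Prod>j\<in>UNIV. [:L x j, L (axis i 1) j:] ^ k j))"
      have p: "poly p t = (\<Sum>k\<in>S. \<alpha> k * (\<Prod>j\<in>UNIV. L (x + t *s axis i 1) j ^ k j))" for t
        by (simp add: p_def poly_sum poly_prod add scale algebra_simps)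
      \<comment> \<open>At a real parameter coordinate \<open>i\<close> is real again, so the
        induction hypothesis for \<open>I\<close> applies.\<close>
      have "poly p (of_real t) = 0" for t
        unfolding p by (rule insert.IH[rule_format]) (use y in \<open>auto simp: x\<close>)
      then have "range complex_of_real \<subseteq> {t. poly p t = 0}"
        by auto
      moreover have "infinite (range complex_of_real)"
        using infinite_UNIV_char_0 inj_of_real by (metis finite_imageD)
      ultimately have "p = 0"
        using poly_roots_finite finite_subset by blast
      moreover have "x + (y $ i) *s axis i 1 = y"
        by (simp add: x vec_eq_iff)
      ultimately show "(\<Sum>k\<in>S. \<alpha> k * (\<Prod>j\<in>UNIV. L y j ^ k j)) = 0"
        using p[of "y $ i"] by simp
    qed
  qed
  from this[OF finite[of UNIV]] show ?thesis by simp
qed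

text \<open>Absolute convergence permits grouping by total degree. Along the ray through
  \<open>z\<close> the series becomes a power series in \<open>t\<close>, which reduces uniqueness
  to one variable.\<close>

lemma multi_power_series_homogeneous_parts:
  fixes z :: "'n::finite \<Rightarrow> complex"
  assumes \<alpha>: "square_summable \<alpha>" and z: "\<And>j. cmod (z j) < 1" and t: "cmod t < 1"
  shows "(\<lambda>m. (\<Sum>k | (\<Sum>j\<in>UNIV. k j) = m. \<alpha> k * (\<Prod>j\<in>UNIV. z j ^ k j)) * t ^ m) sums
    (\<Sum>\<^sub>\<infinity>k. \<alpha> k * (\<Prod>j\<in>UNIV. (t * z j) ^ k j))"
proof -
  let ?f = "\<lambda>k. \<alpha> k * (\<Prod>j\<in>UNIV. (t * z j) ^ k j)"
  let ?D = "\<lambda>m. {k :: 'n \<Rightarrow> nat. (\<Sum>j\<in>UNIV. k j) = m}"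
  have "cmod (t * z j) < 1" for j
    using t z[of j] mult_strict_mono'[of "cmod t" 1 "cmod (z j)" 1] by (simp add: norm_mult)
  then have "?f summable_on UNIV"
    by (rule abs_summable_summable[OF abs_summable_multi_power_series[OF \<alpha>]])
  then have f: "(?f has_sum (\<Sum>\<^sub>\<infinity>k. ?f k)) UNIV"
    by (rule has_sum_infsum)
  \<comment> \<open>Each multi-index has exactly one total degree, so the degree classes partition
    the index set.\<close>
  have bij: "bij_betw snd (Sigma UNIV ?D) UNIV"
    by (rule bij_betwI[where g="\<lambda>k. (\<Sum>j\<in>UNIV. k j, k)"]) auto
  have "((\<lambda>x. ?f (snd x)) has_sum (\<Sum>\<^sub>\<infinity>k. ?f k)) (Sigma UNIV ?D)"
    using f by (subst has_sum_reindex_bij_betw[OF bij])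
  then have "((\<lambda>m. \<Sum>k\<in>?D m. ?f k) has_sum (\<Sum>\<^sub>\<infinity>k. ?f k)) UNIV"
  proof (rule has_sum_SigmaD)
    fix m
    have "finite (?D m)"
      by (rule finite_subset[OF _ finite_multi_index_le[of m]]) auto
    then show "((\<lambda>k. ?f (snd (m, k))) has_sum (\<Sum>k\<in>?D m. ?f k)) (?D m)"
      by (simp add: has_sum_finite)
  qed
  then have "(\<lambda>m. \<Sum>k\<in>?D m. ?f k) sums (\<Sum>\<^sub>\<infinity>k. ?f k)"
    by (rule has_sum_imp_sums)
  moreover have "(\<Sum>k\<in>?D m. ?f k) = (\<Sum>k\<in>?D m. \<alpha> k * (\<Prod>j\<in>UNIV. z j ^ k j)) * t ^ m" for m
    unfolding sum_distrib_right
  proof (rule sum.cong[OF refl])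
    fix k assume "k \<in> ?D m"
    then have "(\<Prod>j\<in>UNIV. t ^ k j) = t ^ m"
      by (simp add: power_sum[symmetric])
    then show "?f k = \<alpha> k * (\<Prod>j\<in>UNIV. z j ^ k j) * t ^ m"
      by (simp add: power_mult_distrib prod.distrib)
  qed
  ultimately show ?thesis
    by (simp only:)
qed

text \<open>If the sum vanishes at 0 and some coefficient of positive index does not, then 0 is an
  isolated zero, against the zeros on the real segment. The constant term is read off at 0.\<close>

lemma power_series_zero_coeffs:
  fixes a :: "nat \<Rightarrow> complex"
  assumes sm: "\<And>t. cmod t < 1 \<Longrightarrow> (\<lambda>n. a n * t ^ n) sums f t"
    and zero: "\<And>t::real. 0 \<le> t \<Longrightarrow> t < 1 \<Longrightarrow> f (of_real t) = 0"
  shows "a m = 0"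
proof (cases "m = 0")
  case True
  have "(\<lambda>n. a n * 0 ^ n) sums a 0"
    by (rule powser_sums_zero)
  moreover have "(\<lambda>n. a n * 0 ^ n) sums f 0"
    by (rule sm) simp
  ultimately have "a 0 = f 0"
    by (rule sums_unique2)
  with zero[of 0] True show ?thesis
    by simp
next
  case False
  show ?thesis
  proof (rule ccontr)
    assume m: "a m \<noteq> 0"
    obtain s where s: "s > 0" "\<And>z. z \<in> cball 0 s - {0} \<Longrightarrow> f z \<noteq> 0"
    proof (rule powser_0_nonzero[of 1 0 a f m])
      show "(\<lambda>n. a n * (t - 0) ^ n) sums f t" if "norm (t - 0) < 1" for t
        using sm that by simp
    qed (use zero[of 0] m False in simp_all)
    \<comment> \<open>A positive real point inside the zero-free punctured disc and also below 1,
      where \<open>f\<close> is known to vanish.\<close>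
    define t where "t = min s (1 / 2)"
    have "0 < t" "t < 1" "t \<le> s"
      using s(1) by (auto simp: t_def)
    with s(2)[of "of_real t"] zero[of t] show False
      by simp
  qed
qed

text \<open>Along small real rays each homogeneous part \<open>P\<close> vanishes separately.
  Homogeneity carries this to all real vectors, the polynomial identity to all complex vectors, and
  surjectivity of \<open>L\<close> to all arguments of \<open>P\<close>, whose coefficients are then
  0.\<close>

lemma multi_power_series_unique:
  fixes L :: "complex^'n \<Rightarrow> 'm::finite \<Rightarrow> complex" and \<alpha> :: "('m \<Rightarrow> nat) \<Rightarrow> complex"
  assumes add: "\<And>x y j. L (x + y) j = L x j + L y j"
    and scale: "\<And>c x j. L (c *s x) j = c * L x j"
    and surj: "\<And>z. \<exists>y. L y = z"
    and \<alpha>: "square_summable \<alpha>"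
    and \<epsilon>: "\<epsilon> > 0"
    and small: "\<And>(y :: real^'n) j. norm y < \<epsilon> \<Longrightarrow> cmod (L (\<chi> i. of_real (y $ i)) j) < 1"
    and zero: "\<And>y :: real^'n. norm y < \<epsilon> \<Longrightarrow>
      (\<Sum>\<^sub>\<infinity>k. \<alpha> k * (\<Prod>j\<in>UNIV. L (\<chi> i. of_real (y $ i)) j ^ k j)) = 0"
  shows "\<alpha> = (\<lambda>_. 0)"
proof
  fix l :: "'m \<Rightarrow> nat"
  define c where "c y = (\<chi> i. complex_of_real (y $ i))" for y :: "real^'n"
  have c_scale: "c (t *\<^sub>R y) = of_real t *s c y" for t y
    by (simp add: c_def vec_eq_iff)
  define m where "m = (\<Sum>j\<in>UNIV. l j)"
  define S where "S = {k :: 'm \<Rightarrow> nat. (\<Sum>j\<in>UNIV. k j) = m}"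
  define P where "P z = (\<Sum>k\<in>S. \<alpha> k * (\<Prod>j\<in>UNIV. z j ^ k j))" for z
  have fin: "finite S"
    unfolding S_def by (rule finite_subset[OF _ finite_multi_index_le[of m]]) auto
  have P_small: "P (L (c y)) = 0" if y: "norm y < \<epsilon>" for y
    unfolding P_def S_def
  proof (rule power_series_zero_coeffs)
    fix t :: complex assume "cmod t < 1"
    with \<alpha> small[OF y, folded c_def]
    show "(\<lambda>n. (\<Sum>k | (\<Sum>j\<in>UNIV. k j) = n. \<alpha> k * (\<Prod>j\<in>UNIV. L (c y) j ^ k j)) * t ^ n) sums
      (\<Sum>\<^sub>\<infinity>k. \<alpha> k * (\<Prod>j\<in>UNIV. (t * L (c y) j) ^ k j))"
      by (rule multi_power_series_homogeneous_parts)
  next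
    fix t :: real assume t: "0 \<le> t" "t < 1"
    have "norm (t *\<^sub>R y) < \<epsilon>"
      using t y mult_left_le_one_le[of "norm y" t] by simp
    from zero[OF this, folded c_def]
    show "(\<Sum>\<^sub>\<infinity>k. \<alpha> k * (\<Prod>j\<in>UNIV. (complex_of_real t * L (c y) j) ^ k j)) = 0"
      by (simp add: c_scale scale)
  qed
  have P_scale: "P (\<lambda>j. s * z j) = s ^ m * P z" for s z
    unfolding P_def sum_distrib_left
  proof (rule sum.cong[OF refl])
    fix k assume "k \<in> S"
    then have "(\<Prod>j\<in>UNIV. s ^ k j) = s ^ m"
      by (simp add: S_def power_sum[symmetric])
    then show "\<alpha> k * (\<Prod>j\<in>UNIV. (s * z j) ^ k j) = s ^ m * (\<alpha> k * (\<Prod>j\<in>UNIV. z j ^ k j))"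
      by (simp add: power_mult_distrib prod.distrib)
  qed
  have P_real: "P (L (c y)) = 0" for y
  proof -
    \<comment> \<open>The factor shrinks \<open>y\<close> into the ball of radius \<epsilon>; the
      added 1 keeps the denominator positive when \<open>y\<close> is 0.\<close>
    define s where "s = \<epsilon> / (2 * (norm y + 1))"
    have pos: "0 < 2 * (norm y + 1)"
      by (intro mult_pos_pos add_nonneg_pos) auto
    have s: "s > 0"
      unfolding s_def by (rule divide_pos_pos[OF \<epsilon> pos])
    have "s * norm y < s * (2 * (norm y + 1))"
    proof (rule mult_strict_left_mono[OF _ s])
      show "norm y < 2 * (norm y + 1)"
        by (smt (verit) norm_ge_zero)
    qed
    also have "\<dots> = \<epsilon>"
      using pos unfolding s_def by (intro nonzero_eq_divide_eq[THEN iffD1]) auto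
    finally have "norm (s *\<^sub>R y) < \<epsilon>"
      using s by simp
    then have "P (L (c (s *\<^sub>R y))) = 0"
      by (rule P_small)
    moreover have "L (c (s *\<^sub>R y)) = (\<lambda>j. of_real s * L (c y) j)"
      by (rule ext) (simp add: c_scale scale)
    ultimately have "of_real s ^ m * P (L (c y)) = 0"
      by (simp add: P_scale)
    then show ?thesis
      using s by simp
  qed
  have "P (L y) = 0" for y
    unfolding P_def
  proof (rule polynomial_zero_on_complexification[OF add scale])
    fix y :: "complex^'n" assume y: "\<And>i. y $ i \<in> \<real>"
    have "y = c (\<chi> i. Re (y $ i))"
      using y by (simp add: c_def vec_eq_iff)
    with P_real show "(\<Sum>k\<in>S. \<alpha> k * (\<Prod>j\<in>UNIV. L y j ^ k j)) = 0"
      unfolding P_def by metis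
  qed
  then have P_zero: "P z = 0" for z
    using surj[of z] by auto
  show "\<alpha> l = 0"
  proof (rule multi_polynomial_coeffs_zero[OF fin, of \<alpha>])
    show "(\<Sum>k\<in>S. \<alpha> k * (\<Prod>j\<in>UNIV. z j ^ k j)) = 0" for z
      using P_zero[of z] by (simp only: P_def)
  qed (simp add: S_def m_def)
qed

section \<open>Accumulation of the eigenvalue products at 0\<close>

lemma closure_multi_powers:
  fixes lam :: "'n::finite \<Rightarrow> complex"
  assumes lam: "\<And>j. cmod (lam j) < 1"
  shows "closure (range (\<lambda>k::'n \<Rightarrow> nat. \<Prod>j\<in>UNIV. lam j ^ k j))
    = insert 0 {\<Prod>j\<in>UNIV. lam j ^ k j | k :: 'n \<Rightarrow> nat. True}"
proof -
  let ?m = "\<lambda>k::'n \<Rightarrow> nat. \<Prod>j\<in>UNIV. lam j ^ k j"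
  let ?R = "range ?m"
  have abs: "(\<lambda>k. norm (?m k)) summable_on UNIV"
    using summable_multi_geometric[of "\<lambda>j. cmod (lam j)"] lam
    by (simp add: prod_norm[symmetric] norm_power)
  \<comment> \<open>Each index in this set contributes at least \<open>e\<close> to a convergent sum
    of moduli, which bounds the number of such indices.\<close>
  have fin: "finite {k. e \<le> cmod (?m k)}" if "e > 0" for e
  proof (rule finite_if_finite_subsets_card_bdd[THEN conjunct1])
    fix G assume G: "G \<subseteq> {k. e \<le> cmod (?m k)}" "finite G"
    have "real (card G) * e \<le> (\<Sum>k\<in>G. cmod (?m k))"
      by (rule sum_bounded_below) (use G in auto)
    also have "\<dots> \<le> infsum (\<lambda>k. cmod (?m k)) UNIV"
      by (rule finite_sum_le_infsum[OF abs]) (use G in auto)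
    finally have "real (card G) \<le> infsum (\<lambda>k. cmod (?m k)) UNIV / e"
      using that by (simp add: field_simps)
    then show "card G \<le> nat \<lceil>infsum (\<lambda>k. cmod (?m k)) UNIV / e\<rceil>"
      by linarith
  qed
  have sub: "closure ?R \<subseteq> insert 0 ?R"
  proof
    fix x assume x: "x \<in> closure ?R"
    show "x \<in> insert 0 ?R"
    proof (cases "x = 0")
      case False
      \<comment> \<open>Only these finitely many products lie outside or on the circle of radius
        \<open>cmod x / 2\<close>; the rest stay away from \<open>x\<close>. So \<open>x\<close> is
        one of them.\<close>
      let ?F = "?m ` {k. cmod x / 2 \<le> cmod (?m k)}"
      have "finite ?F"
        by (intro finite_imageI fin) (use False in simp)
      then have "closed (?F \<union> cball 0 (cmod x / 2))"
        by (intro closed_Un finite_imp_closed closed_cball)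
      moreover have "?R \<subseteq> ?F \<union> cball 0 (cmod x / 2)"
        by auto
      ultimately have "x \<in> ?F \<union> cball 0 (cmod x / 2)"
        using x closure_minimal by blast
      with False show ?thesis
        by auto
    qed simp
  qed
  \<comment> \<open>Constant multi-indices give products tending to 0, so 0 belongs to the closure
    even if no eigenvalue vanishes.\<close>
  have "(\<lambda>i. ?m (\<lambda>j. i)) \<longlonglongrightarrow> 0"
  proof -
    have "(\<lambda>i. \<Prod>j\<in>UNIV. lam j ^ i) \<longlonglongrightarrow> (\<Prod>j\<in>(UNIV::'n set). 0)"
      by (intro tendsto_prod LIMSEQ_power_zero lam)
    then show ?thesis by (simp add: power_0_left)
  qed
  then have "0 \<in> closure ?R"
    by (auto simp: closure_sequential intro!: exI[of _ "\<lambda>i. ?m (\<lambda>j. i)"])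
  with sub closure_subset[of ?R] show ?thesis
    by auto
qed

section \<open>The Koopman operator in eigencoordinates\<close>

lemma Ck_on_1_imp_continuous_on:
  assumes "Ck_on 1 S f"
  shows "continuous_on S f"
proof -
  have "f differentiable (at x)" if "x \<in> S" for x
    using assms that by (simp add: One_nat_def)
  then show ?thesis
    by (intro continuous_at_imp_continuous_on ballI differentiable_imp_continuous_within)
qed

text \<open>The image of \<open>B\<close> is the preimage of \<open>B\<close> under the continuous
  inverse. Applied to \<open>h\<close>, this provides a full neighbourhood of 0 on which to compare
  coefficients.\<close>

lemma C1_diffeo_on_open_image:
  assumes f: "C1_diffeo_on S f" and B: "open B" "B \<subseteq> S"
  shows "open (f ` B)"
proof -
  have "continuous_on (f ` S) (inv_into S f)" "open (f ` S)" and inj: "inj_on f S"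
    using f Ck_on_1_imp_continuous_on unfolding C1_diffeo_on_def by blast+
  then have "open (f ` S \<inter> inv_into S f -` B)"
    using B(1) continuous_open_preimage by blast
  also have "f ` S \<inter> inv_into S f -` B = f ` B"
    using inj B(2) by (auto simp: inv_into_f_f)
  finally show ?thesis .
qed

section \<open>Linear algebra of the adjoint basis\<close>

lemma cinner_vec_add: "cinner_vec (x + y) u = cinner_vec x u + cinner_vec y u"
  by (simp add: cinner_vec_def distrib_right sum.distrib)

lemma cinner_vec_scale: "cinner_vec (c *s x) u = c * cinner_vec x u"
  by (simp add: cinner_vec_def sum_distrib_left mult.assoc)

lemma cinner_vec_zero: "cinner_vec 0 u = 0"
  by (simp add: cinner_vec_def)

lemma cinner_vec_sum: "cinner_vec (\<Sum>i\<in>I. f i) u = (\<Sum>i\<in>I. cinner_vec (f i) u)"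
  by (induction I rule: infinite_finite_induct) (auto simp: cinner_vec_add cinner_vec_zero)

text \<open>Both sides are linear in \<open>y\<close> and agree on the eigenvectors, which
  span.\<close>

lemma cinner_vec_eigenvector:
  assumes ev: "eigenbasis A lam ev" and adj: "adjoint_basis ev w"
  shows "cinner_vec (map_matrix complex_of_real A *v y) (w j) = lam j * cinner_vec y (w j)"
proof -
  let ?M = "map_matrix complex_of_real A"
  let ?T = "{y. cinner_vec (?M *v y) (w j) = lam j * cinner_vec y (w j)}"
  have "vec.subspace ?T"
    by (rule vec.subspaceI)
       (auto simp: matrix_vector_right_distrib cinner_vec_add cinner_vec_scale cinner_vec_zero
         vec.scale distrib_left mult.left_commute)
  moreover have "range ev \<subseteq> ?T"
    using ev adj by (auto simp: eigenbasis_def adjoint_basis_def cinner_vec_scale)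
  ultimately have "vec.span (range ev) \<subseteq> ?T"
    by (intro vec.span_minimal)
  with ev show ?thesis
    by (auto simp: eigenbasis_def)
qed

text \<open>Again a linear identity checked on the spanning eigenvectors; it makes the
  eigencoordinates separate points.\<close>

lemma eigenbasis_expansion:
  assumes ev: "eigenbasis A lam ev" and adj: "adjoint_basis ev w"
  shows "y = (\<Sum>j\<in>UNIV. cinner_vec y (w j) *s ev j)"
proof -
  let ?T = "{y. y = (\<Sum>j\<in>UNIV. cinner_vec y (w j) *s ev j)}"
  have "vec.subspace ?T"
  proof (rule vec.subspaceI)
    fix c x assume "x \<in> ?T"
    then have "c *s x = c *s (\<Sum>j\<in>UNIV. cinner_vec x (w j) *s ev j)"
      by (intro arg_cong[of _ _ "(*s) c"]) simp
    then show "c *s x \<in> ?T"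
      unfolding mem_Collect_eq cinner_vec_scale
      by (simp only: vec.scale_sum_right vec.scale_scale)
  qed (auto simp: cinner_vec_add cinner_vec_zero vec.scale_left_distrib sum.distrib)
  moreover have "ev i = (\<Sum>j\<in>UNIV. cinner_vec (ev i) (w j) *s ev j)" for i
  proof -
    have "(\<Sum>j\<in>UNIV. cinner_vec (ev i) (w j) *s ev j) = (\<Sum>j\<in>UNIV. if j = i then ev i else 0)"
      using adj by (intro sum.cong) (auto simp: adjoint_basis_def)
    then show ?thesis by simp
  qed
  then have "range ev \<subseteq> ?T"
    by auto
  ultimately have "vec.span (range ev) \<subseteq> ?T"
    by (intro vec.span_minimal)
  with ev show ?thesis
    by (auto simp: eigenbasis_def)
qed

lemma eigencoord_matrix_mult:
  assumes "eigenbasis A lam ev" "adjoint_basis ev w"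
  shows "eigencoord w j (A *v y) = lam j * eigencoord w j y"
proof -
  have "(\<chi> i. complex_of_real ((A *v y) $ i))
      = map_matrix complex_of_real A *v (\<chi> i. complex_of_real (y $ i))"
    by (simp add: vec_eq_iff matrix_vector_mult_def map_matrix_def)
  then show ?thesis
    by (simp add: eigencoord_def cinner_vec_eigenvector[OF assms])
qed

lemma eigencoord_eq_0_imp:
  assumes "eigenbasis A lam ev" "adjoint_basis ev w" "\<And>j. eigencoord w j y = 0"
  shows "y = 0"
proof -
  have "(\<chi> i. complex_of_real (y $ i)) = 0"
    using eigenbasis_expansion[OF assms(1,2), of "\<chi> i. complex_of_real (y $ i)"] assms(3)
    by (simp add: eigencoord_def)
  then show ?thesis
    by (simp add: vec_eq_iff)
qed

section \<open>Isometry of the pullback space with the coefficients, and the action on them\<close>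

locale koopman_setting =
  fixes \<Phi> h g :: "real^'n \<Rightarrow> real^'n"
    and A :: "real^'n^'n"
    and lam :: "'n \<Rightarrow> complex"
    and ev w :: "'n \<Rightarrow> complex^'n"
    and B :: "(real^'n) set"
    and c :: "'n \<Rightarrow> real"
  assumes ev: "eigenbasis A lam ev" and adj: "adjoint_basis ev w"
    and lam: "\<And>j. cmod (lam j) < 1"
    and fixed: "\<Phi> 0 = 0"
    and conj: "\<And>x. x \<in> B \<Longrightarrow> h (\<Phi> x) = A *v h x"
    and B0: "0 \<in> B" and inv: "\<Phi> ` B \<subseteq> B"
    and open_hB: "open (h ` B)"
    and c: "\<And>j. 0 < c j"
    and scaled: "\<And>x j. x \<in> B \<Longrightarrow> eigencoord w j (g (h x)) = complex_of_real (c j) * eigencoord w j (h x)"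
    and in_cube: "\<And>x j. x \<in> B \<Longrightarrow> cmod (eigencoord w j (g (h x))) < 1"
begin

definition z :: "real^'n \<Rightarrow> 'n \<Rightarrow> complex" where
  "z x j = eigencoord w j (g (h x))"

text \<open>Positive invariance keeps \<open>\<Phi> x\<close> in \<open>B\<close>, where
  \<open>g\<close> rescales by the same constants as at \<open>x\<close>; in eigencoordinates this
  rescaling commutes with \<open>A\<close>.\<close>

lemma z_Phi:
  assumes "x \<in> B"
  shows "z (\<Phi> x) j = lam j * z x j"
proof -
  have "\<Phi> x \<in> B"
    using assms inv by blast
  from scaled[OF this] scaled[OF assms] show ?thesis
    by (simp add: z_def conj[OF assms] eigencoord_matrix_mult[OF ev adj])
qed

definition J :: "(('n \<Rightarrow> nat) \<Rightarrow> complex) \<Rightarrow> real^'n \<Rightarrow> complex" where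
  "J \<alpha> x = (if x \<in> B then (\<Sum>\<^sub>\<infinity>k. \<alpha> k * (\<Prod>j\<in>UNIV. z x j ^ k j)) else 0)"

lemma pullback_power_series: "pullback (g \<circ> h) B (power_series_fun w ((g \<circ> h) ` B) \<alpha>) = J \<alpha>"
  by (auto simp: fun_eq_iff pullback_def power_series_fun_def J_def z_def)

lemma J_summable:
  assumes "square_summable \<alpha>" "x \<in> B"
  shows "(\<lambda>k. \<alpha> k * (\<Prod>j\<in>UNIV. z x j ^ k j)) summable_on UNIV"
  by (rule abs_summable_summable[OF abs_summable_multi_power_series[OF assms(1)]])
     (simp add: z_def in_cube assms(2))

lemma J_add:
  assumes "square_summable \<alpha>" "square_summable \<beta>"
  shows "J (\<lambda>k. \<alpha> k + \<beta> k) = (\<lambda>x. J \<alpha> x + J \<beta> x)"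
  using infsum_add[OF J_summable[OF assms(1)] J_summable[OF assms(2)]]
  by (auto simp: fun_eq_iff J_def distrib_right)

lemma J_scale: "J (\<lambda>k. t * \<alpha> k) = (\<lambda>x. t * J \<alpha> x)"
  by (auto simp: fun_eq_iff J_def mult.assoc infsum_cmult_right')

text \<open>By conjugacy \<open>h 0\<close> is a fixed point of \<open>A\<close>, and no eigenvalue
  of \<open>A\<close> equals 1.\<close>

lemma h_zero: "h 0 = 0"
proof (rule eigencoord_eq_0_imp[OF ev adj])
  fix j
  have "eigencoord w j (h 0) = lam j * eigencoord w j (h 0)"
    using conj[OF B0] by (metis eigencoord_matrix_mult[OF ev adj] fixed)
  moreover have "lam j \<noteq> 1"
    using lam[of j] by auto
  ultimately show "eigencoord w j (h 0) = 0"
    by simp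
qed

text \<open>The image of \<open>B\<close> under \<open>h\<close> contains a ball around 0. On it the
  coordinates \<open>z\<close> are the restriction of the complex linear map \<open>L\<close> to
  real vectors, so the uniqueness result for power series applies.\<close>

lemma J_eq_zero_imp:
  assumes \<alpha>: "square_summable \<alpha>" and J0: "J \<alpha> = (\<lambda>_. 0)"
  shows "\<alpha> = (\<lambda>_. 0)"
proof -
  have "0 \<in> h ` B"
    using B0 h_zero by (metis image_eqI)
  then obtain \<epsilon> where \<epsilon>: "\<epsilon> > 0" "ball 0 \<epsilon> \<subseteq> h ` B"
    using open_hB open_contains_ball by metis
  define L where "L y j = complex_of_real (c j) * cinner_vec y (w j)" for y j
  have Lz: "\<exists>x\<in>B. (\<lambda>j. L (\<chi> i. of_real (y $ i)) j) = z x" if "norm y < \<epsilon>" for y :: "real^'n"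
  proof -
    have "y \<in> h ` B"
      using \<epsilon>(2) that by auto
    then obtain x where x: "x \<in> B" "y = h x"
      by blast
    have "L (\<chi> i. of_real (y $ i)) j = of_real (c j) * eigencoord w j y" for j
      by (simp add: L_def eigencoord_def)
    with x show ?thesis
      by (intro bexI[of _ x]) (auto simp: fun_eq_iff z_def scaled)
  qed
  show ?thesis
  proof (rule multi_power_series_unique[of L, OF _ _ _ \<alpha> \<epsilon>(1)])
    show "L (x + y) j = L x j + L y j" for x y j
      by (simp add: L_def cinner_vec_add distrib_left)
    show "L (t *s x) j = t * L x j" for t x j
      by (simp add: L_def cinner_vec_scale)
    show "\<exists>y. L y = u" for u
    proof
      \<comment> \<open>The adjoint basis reads off coefficients, so dividing \<open>u j\<close> by
        the scaling constant gives a preimage of \<open>u\<close> under \<open>L\<close>.\<close>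
      have "cinner_vec (\<Sum>j\<in>UNIV. (u j / of_real (c j)) *s ev j) (w i) = u i / of_real (c i)" for i
      proof -
        have "cinner_vec (\<Sum>j\<in>UNIV. (u j / of_real (c j)) *s ev j) (w i)
            = (\<Sum>j\<in>UNIV. if j = i then u i / of_real (c i) else 0)"
          unfolding cinner_vec_sum cinner_vec_scale
          using adj by (intro sum.cong) (auto simp: adjoint_basis_def)
        then show ?thesis by simp
      qed
      then show "L (\<Sum>j\<in>UNIV. (u j / of_real (c j)) *s ev j) = u"
        using c by (auto simp: fun_eq_iff L_def less_le)
    qed
    fix y :: "real^'n" assume "norm y < \<epsilon>"
    then obtain x where x: "x \<in> B" "(\<lambda>j. L (\<chi> i. of_real (y $ i)) j) = z x"
      using Lz by blast
    show "cmod (L (\<chi> i. of_real (y $ i)) j) < 1" for j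
      using in_cube[OF x(1)] fun_cong[OF x(2), of j] by (simp add: z_def)
    have "J \<alpha> x = 0"
      by (simp add: J0)
    then show "(\<Sum>\<^sub>\<infinity>k. \<alpha> k * (\<Prod>j\<in>UNIV. L (\<chi> i. of_real (y $ i)) j ^ k j)) = 0"
      using x(1) fun_cong[OF x(2)] by (simp add: J_def)
  qed
qed

text \<open>Two coefficient families of the same function differ by one that \<open>J\<close> sends
  to 0, so the definite description picks out \<open>\<alpha>\<close>.\<close>

lemma pullback_coeffs_J:
  assumes \<alpha>: "square_summable \<alpha>"
  shows "pullback_coeffs w g h B (J \<alpha>) = \<alpha>"
  unfolding pullback_coeffs_def pullback_power_series
proof (rule the_equality)
  fix \<beta> assume \<beta>: "square_summable \<beta> \<and> J \<alpha> = J \<beta>"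
  have "J (\<lambda>k. \<beta> k + - 1 * \<alpha> k) = (\<lambda>x. J \<beta> x + - 1 * J \<alpha> x)"
    using \<alpha> \<beta> square_summable_scale(1)[OF \<alpha>, of "- 1"] by (subst J_add) (simp_all only: J_scale)
  then have "(\<lambda>k. \<beta> k + - 1 * \<alpha> k) = (\<lambda>_. 0)"
    using \<alpha> \<beta> by (intro J_eq_zero_imp square_summable_add(1) square_summable_scale(1)) auto
  then show "\<beta> = \<alpha>"
    by (auto simp: fun_eq_iff)
qed (use \<alpha> in simp)

text \<open>Once coefficients are unique, the pullback norm is the norm of the coefficient family,
  and \<open>J\<close> is an isometry onto the pullback space. Completeness and the theory of
  diagonal operators carry over.\<close>

sublocale l2_coordinates "pullback_space w g h B" "pullback_norm w g h B" J
proof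
  show "pullback_space w g h B = J ` Collect square_summable"
    by (auto simp: pullback_space_def polydisc_hardy_space_def pullback_power_series
        simp flip: pullback_power_series)
qed (simp_all add: J_add J_scale pullback_norm_def pullback_coeffs_J l2_norm_def)

text \<open>By \<open>z_Phi\<close> every monomial in \<open>z\<close> is an eigenfunction, with
  eigenvalue the corresponding product of powers of \<open>lam\<close>.\<close>

lemma koopman_J:
  assumes "square_summable \<alpha>"
  shows "koopman B \<Phi> (J \<alpha>) = J (\<lambda>k. (\<Prod>j\<in>UNIV. lam j ^ k j) * \<alpha> k)"
proof
  fix x
  show "koopman B \<Phi> (J \<alpha>) x = J (\<lambda>k. (\<Prod>j\<in>UNIV. lam j ^ k j) * \<alpha> k) x"
  proof (cases "x \<in> B")
    case True
    then have "\<Phi> x \<in> B"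
      using inv by blast
    with True show ?thesis
      by (simp add: koopman_def pullback_def J_def z_Phi power_mult_distrib prod.distrib mult_ac)
  qed (simp add: koopman_def pullback_def J_def)
qed

lemma koopman_spectral:
  "scalar_type_spectral_operator (pullback_space w g h B) (pullback_norm w g h B) (koopman B \<Phi>)"
  "op_spectrum (pullback_space w g h B) (pullback_norm w g h B) (koopman B \<Phi>)
    = insert 0 {\<Prod>i\<in>UNIV. lam i ^ k i | k :: 'n \<Rightarrow> nat. True}"
proof -
  let ?m = "\<lambda>k::'n \<Rightarrow> nat. \<Prod>j\<in>UNIV. lam j ^ k j"
  have "cmod (?m k) \<le> 1" for k
    unfolding prod_norm[symmetric] norm_power
    by (intro prod_le_1 conjI power_le_one zero_le_power norm_ge_zero less_imp_le[OF lam])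
  then have bdd: "bounded (range ?m)"
    by (auto simp: bounded_iff)
  have U: "koopman B \<Phi> f = diag ?m f" if "f \<in> pullback_space w g h B" for f
    using that by (auto simp: carrier koopman_J)
  show "scalar_type_spectral_operator (pullback_space w g h B) (pullback_norm w g h B) (koopman B \<Phi>)"
    by (rule scalar_type_diag[OF bdd U])
  show "op_spectrum (pullback_space w g h B) (pullback_norm w g h B) (koopman B \<Phi>)
    = insert 0 {\<Prod>i\<in>UNIV. lam i ^ k i | k :: 'n \<Rightarrow> nat. True}"
    using op_spectrum_diag[OF bdd U] closure_multi_powers[of lam, OF lam] by simp
qed

end

text \<open>The point 0 is listed separately: it is itself a product only if some eigenvalue is 0,
  but it is always a limit of products, and the spectrum is the closure of the set of
  products.\<close>

theorem proposition4p9: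
  fixes \<Phi> v h g :: "real^'n \<Rightarrow> real^'n"
    and A :: "real^'n^'n"
    and lam :: "'n \<Rightarrow> complex"
    and ev w :: "'n \<Rightarrow> complex^'n"
    and B :: "(real^'n) set"
    and r :: real
  assumes "\<And>x. \<Phi> x = A *v x + v x"
    and "Ck_on 2 UNIV v"
    and "\<Phi> 0 = 0"
    and "(\<Phi> has_derivative (\<lambda>y. A *v y)) (at 0)"
    and "eigenbasis A lam ev"
    and "\<And>j. cmod (lam j) < 1"
    and "adjoint_basis ev w"
    and "C1_diffeo_on (basin \<Phi>) h"
    and "\<And>x. x \<in> basin \<Phi> \<Longrightarrow> h (\<Phi> x) = A *v h x"
    and "B \<subseteq> basin \<Phi>" "open B" "bounded B" "simply_connected B" "0 \<in> B" "\<Phi> ` B \<subseteq> B"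
    and "smooth_boundary B"
    and "bounded (h ` B)"
    and "r > 0" "h ` B \<subseteq> open_cube w r"
    and "C1_diffeo_on (open_cube w r) g"
    and "scales_coords_on w (open_cube w r) g"
    and "g ` open_cube w r = open_cube w 1"
  shows "scalar_type_spectral_operator (pullback_space w g h B) (pullback_norm w g h B) (koopman B \<Phi>)
    \<and> op_spectrum (pullback_space w g h B) (pullback_norm w g h B) (koopman B \<Phi>)
        = insert 0 {\<Prod>i\<in>UNIV. lam i ^ k i | k :: 'n \<Rightarrow> nat. True}"
proof -
  obtain c where c: "\<And>j. 0 < c j"
    "\<And>y j. y \<in> open_cube w r \<Longrightarrow> eigencoord w j (g y) = complex_of_real (c j) * eigencoord w j y"
    using assms(21) unfolding scales_coords_on_def by blast
  have cube: "h x \<in> open_cube w r" "g (h x) \<in> open_cube w 1" if "x \<in> B" for x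
    using that assms(19,22) by blast+
  interpret koopman_setting \<Phi> h g A lam ev w B c
  proof
    show "open (h ` B)"
      using C1_diffeo_on_open_image assms(8,10,11) by blast
    show "cmod (eigencoord w j (g (h x))) < 1" if "x \<in> B" for x j
      using cube(2)[OF that] by (simp add: open_cube_def)
  qed (use assms c cube in auto)
  show ?thesis
    using koopman_spectral by blast
qed

end
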